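(* Let $(A_n,B_n)_{n\ge2}$ be the twin Seidel matrix sequence, $A_n=(a_n(m,k))$. Then, as formal power series in $x,y,z$, $$\sum a_{2n}(m,k)\frac{x^{m-1}}{(m-1)!}\frac{y^{k-m-1}}{(k-m-1)!}\frac{z^{2n-k-1}}{(2n-k-1)!}=\frac{\cos x\,\cos z\,\sin(x+y+z)}{\cos^2(x+y+z)},$$ the sum being over all integers $n\ge1$, $m,k$ with $2\le m+1\le k\le 2n-1$, and $$\sum a_{2n}(m,k)\frac{x^{2n-m-1}}{(2n-m-1)!}\frac{y^{m-k-1}}{(m-k-1)!}\frac{z^{k-1}}{(k-1)!}=\frac{\cos x\,\sin z}{\cos(x+y+z)}+\frac{\sin x\,\cos(x+y)}{\cos^2(x+y+z)},$$ the sum being over all integers $n\ge1$, $m,k$ with $2\le k+1\le m\le 2n-1$.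
   Context: Twin Seidel matrix sequence: the unique sequence of square matrices $A_n=(a_n(m,k))_{1\le m,k\le n}$, $B_n=(b_n(m,k))_{1\le m,k\le n}$ ($n\ge2$) with nonnegative integer entries satisfying, with $a_n(m,\bullet)=\sum_k a_n(m,k)$, $a_n(\bullet,k)=\sum_m a_n(m,k)$ and similarly for $b$: (TS1) all diagonal entries are $0$, except $a_2(1,1)=1$; (TS2) for $n\ge3$: $a_n(m,n)=b_n(m,n)=0$ for all $m$, $a_n(n,k)=b_n(1,k)=0$ for all $k$, and $b_n(n,1)=0$; (TS3) $A_2=\begin{pmatrix}1&0\\0&0\end{pmatrix}$, $B_2=\begin{pmatrix}0&0\\1&0\end{pmatrix}$; (TS4) for $n\ge3$: $b_n(n,k)=a_{n-1}(\bullet,k-1)$ for $2\le k\le n-1$; $b_n(n-1,k)=a_{n-1}(\bullet,k)$ for $1\le k\le n-2$; $b_n(m+1,k)-b_n(m,k)=a_{n-1}(m,k)$ for $2\le k+1\le m\le n-2$; $b_n(m+1,k)-b_n(m,k)=a_{n-1}(m,k-1)$ for $3\le m+2\le k\le n-1$; (TS5) for $n\ge3$: $a_n(1,k)=b_{n-1}(\bullet,k-1)$ for $2\le k\le n-1$; $a_n(m+1,k)-a_n(m,k)=-b_{n-1}(m,k-1)$ for $3\le m+2\le k\le n-1$; $a_n(m+1,k)-a_n(m,k)=-b_{n-1}(m,k)$ for $2\le k+1\le m\le n-1$. *)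

theory Defs
  imports Complex_Main "HOL-Computational_Algebra.Formal_Power_Series"
begin

text \<open>
  The ring of formal power series in x, y, z over the reals is represented as the iterated power
  series ring; the outermost variable is z, the innermost one is x.
\<close>

type_synonym fps3 = "real fps fps fps"

definition coeff3 :: "fps3 \<Rightarrow> nat \<Rightarrow> nat \<Rightarrow> nat \<Rightarrow> real" where
  "coeff3 f i j l = fps_nth (fps_nth (fps_nth f l) j) i"

definition const3 :: "real \<Rightarrow> fps3" where
  "const3 c = fps_const (fps_const (fps_const c))"

definition X3 :: fps3 where "X3 = fps_const (fps_const fps_X)"
definition Y3 :: fps3 where "Y3 = fps_const fps_X"
definition Z3 :: fps3 where "Z3 = fps_X"

text \<open>
  The sum of a family of power series in which every monomial occurs in only finitely many members.
  (The metric of the library on iterated power series only sees the outermost variable, so its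
  notion of convergence is not the right one here.)
\<close>

definition formal_sum :: "('i \<Rightarrow> fps3) \<Rightarrow> 'i set \<Rightarrow> fps3" where
  "formal_sum F S =
     Abs_fps (\<lambda>l. Abs_fps (\<lambda>j. Abs_fps (\<lambda>i.
       \<Sum>s \<in> {s \<in> S. coeff3 (F s) i j l \<noteq> 0}. coeff3 (F s) i j l)))"

text \<open>
  Substitution of a series \<open>u\<close> without constant term into a univariate series.
  The library's composition would only allow a \<open>u\<close> divisible by z.
\<close>

definition subst3 :: "real fps \<Rightarrow> fps3 \<Rightarrow> fps3" where
  "subst3 f u = formal_sum (\<lambda>n. const3 (fps_nth f n) * u ^ n) UNIV"

definition sin3 :: "fps3 \<Rightarrow> fps3" where "sin3 u = subst3 (fps_sin 1) u"
definition cos3 :: "fps3 \<Rightarrow> fps3" where "cos3 u = subst3 (fps_cos 1) u"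

definition divpow :: "fps3 \<Rightarrow> nat \<Rightarrow> fps3" where
  "divpow u n = const3 (1 / fact n) * u ^ n"

definition colsum :: "(nat \<Rightarrow> nat \<Rightarrow> nat \<Rightarrow> nat) \<Rightarrow> nat \<Rightarrow> nat \<Rightarrow> nat" where
  "colsum c n k = (\<Sum>m = 1..n. c n m k)"

text \<open>
  The entry of \<open>A\<^sub>n\<close> in row \<open>m\<close> and column \<open>k\<close> is \<open>a n m k\<close>; only the values for
  \<open>n \<ge> 2\<close> and \<open>1 \<le> m, k \<le> n\<close> are meaningful.  Differences are taken in the integers.
\<close>

definition twin_seidel ::
  "(nat \<Rightarrow> nat \<Rightarrow> nat \<Rightarrow> nat) \<Rightarrow> (nat \<Rightarrow> nat \<Rightarrow> nat \<Rightarrow> nat) \<Rightarrow> bool" where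
  "twin_seidel a b \<longleftrightarrow>
    (\<forall>n\<ge>2. \<forall>m\<in>{1..n}. a n m m = (if n = 2 \<and> m = 1 then 1 else 0) \<and> b n m m = 0) \<and>
    (\<forall>n\<ge>3. (\<forall>m\<in>{1..n}. a n m n = 0 \<and> b n m n = 0) \<and>
            (\<forall>k\<in>{1..n}. a n n k = 0 \<and> b n 1 k = 0) \<and>
            b n n 1 = 0) \<and>
    a 2 1 1 = 1 \<and> a 2 1 2 = 0 \<and> a 2 2 1 = 0 \<and> a 2 2 2 = 0 \<and>
    b 2 1 1 = 0 \<and> b 2 1 2 = 0 \<and> b 2 2 1 = 1 \<and> b 2 2 2 = 0 \<and>
    (\<forall>n\<ge>3.
      (\<forall>k. 2 \<le> k \<and> k \<le> n - 1 \<longrightarrow> b n n k = colsum a (n - 1) (k - 1)) \<and>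
      (\<forall>k. 1 \<le> k \<and> k \<le> n - 2 \<longrightarrow> b n (n - 1) k = colsum a (n - 1) k) \<and>
      (\<forall>m k. 2 \<le> k + 1 \<and> k + 1 \<le> m \<and> m \<le> n - 2 \<longrightarrow>
        int (b n (m + 1) k) - int (b n m k) = int (a (n - 1) m k)) \<and>
      (\<forall>m k. 3 \<le> m + 2 \<and> m + 2 \<le> k \<and> k \<le> n - 1 \<longrightarrow>
        int (b n (m + 1) k) - int (b n m k) = int (a (n - 1) m (k - 1)))) \<and>
    (\<forall>n\<ge>3.
      (\<forall>k. 2 \<le> k \<and> k \<le> n - 1 \<longrightarrow> a n 1 k = colsum b (n - 1) (k - 1)) \<and>
      (\<forall>m k. 3 \<le> m + 2 \<and> m + 2 \<le> k \<and> k \<le> n - 1 \<longrightarrow>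
        int (a n (m + 1) k) - int (a n m k) = - int (b (n - 1) m (k - 1))) \<and>
      (\<forall>m k. 2 \<le> k + 1 \<and> k + 1 \<le> m \<and> m \<le> n - 1 \<longrightarrow>
        int (a n (m + 1) k) - int (a n m k) = - int (b (n - 1) m k)))"


text \<open>
  The sequence exists, and its meaningful entries are unique.  The Boolean argument selects
  between the entries of \<open>A\<^sub>n\<close> (true) and \<open>B\<^sub>n\<close> (false).
\<close>

fun ts_entry :: "bool \<Rightarrow> nat \<Rightarrow> nat \<Rightarrow> nat \<Rightarrow> nat" where
  "ts_entry c 0 m k = 0"
| "ts_entry c (Suc n) m k =
    (if n = 1 then (if (c \<and> m = 1 \<or> \<not> c \<and> m = 2) \<and> k = 1 then 1 else 0)
     else if m = k \<or> k \<ge> Suc n then 0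
     else if c then (\<Sum>i = m..n. ts_entry False n i (if m < k then k - 1 else k))
     else if m = Suc n then (if k = 1 then 0 else (\<Sum>i = 1..n. ts_entry True n i (k - 1)))
     else (\<Sum>i = 1..<m. ts_entry True n i (if m < k then k - 1 else k)))"

lemma ts_entry_rec:
  assumes "n \<ge> 3"
  shows "ts_entry True n m k =
      (if m = k \<or> k \<ge> n then 0
       else (\<Sum>i = m..n-1. ts_entry False (n-1) i (if m < k then k - 1 else k)))"
    and "ts_entry False n m k =
      (if m = k \<or> k \<ge> n then 0
       else if m = n then (if k = 1 then 0 else (\<Sum>i = 1..n-1. ts_entry True (n-1) i (k - 1)))
       else (\<Sum>i = 1..<m. ts_entry True (n-1) i (if m < k then k - 1 else k)))"
proof -
  obtain p where "n = Suc p" "p \<ge> 2" using assms by (cases n) auto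
  then show "ts_entry True n m k =
      (if m = k \<or> k \<ge> n then 0
       else (\<Sum>i = m..n-1. ts_entry False (n-1) i (if m < k then k - 1 else k)))"
    and "ts_entry False n m k =
      (if m = k \<or> k \<ge> n then 0
       else if m = n then (if k = 1 then 0 else (\<Sum>i = 1..n-1. ts_entry True (n-1) i (k - 1)))
       else (\<Sum>i = 1..<m. ts_entry True (n-1) i (if m < k then k - 1 else k)))"
    by auto
qed

lemma ts_entry_2:
  "ts_entry c 2 m k = (if (c \<and> m = 1 \<or> \<not> c \<and> m = 2) \<and> k = 1 then 1 else 0)"
  by (simp add: numeral_2_eq_2)

declare ts_entry.simps [simp del]

lemma ts_entry_last_row:
  assumes "n \<ge> 2" "n \<le> m"
  shows "ts_entry True n m k = 0"
proof (cases "n = 2")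
  case True
  then show ?thesis using assms by (simp add: ts_entry_2)
next
  case False
  then have "n \<ge> 3" using assms by simp
  then show ?thesis using assms by (simp add: ts_entry_rec)
qed

lemma twin_seidel_ts_entry: "twin_seidel (ts_entry True) (ts_entry False)"
  unfolding twin_seidel_def
proof (intro conjI allI impI ballI)
  fix n m :: nat assume "2 \<le> n" "m \<in> {1..n}"
  then have "n = 2 \<or> n \<ge> 3" by linarith
  then show "ts_entry True n m m = (if n = 2 \<and> m = 1 then 1 else 0)"
    and "ts_entry False n m m = 0"
    by (auto simp: ts_entry_2 ts_entry_rec)
next
  fix n k :: nat assume n: "3 \<le> n" and k: "1 \<le> k \<and> k \<le> n - 2"
  have "{1..n-1} = insert (n-1) {1..<n-1}" using n by auto
  then have "colsum (ts_entry True) (n-1) k =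
      ts_entry True (n-1) (n-1) k + (\<Sum>i = 1..<n-1. ts_entry True (n-1) i k)"
    by (simp add: colsum_def)
  moreover have "ts_entry True (n-1) (n-1) k = 0"
    using n by (intro ts_entry_last_row) auto
  moreover have "ts_entry False n (n-1) k = (\<Sum>i = 1..<n-1. ts_entry True (n-1) i k)"
  proof -
    have "n - 1 \<noteq> k" "\<not> k \<ge> n" "n - 1 \<noteq> n" "\<not> n - 1 < k" using n k by linarith+
    then show ?thesis by (simp only: ts_entry_rec(2)[OF n] if_False simp_thms)
  qed
  ultimately show "ts_entry False n (n - 1) k = colsum (ts_entry True) (n - 1) k" by simp
next
  fix n m k :: nat assume n: "3 \<le> n" and mk: "3 \<le> m + 2 \<and> m + 2 \<le> k \<and> k \<le> n - 1"
  have "{m..n-1} = insert m {m+1..n-1}" using mk by auto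
  then show "int (ts_entry True n (m + 1) k) - int (ts_entry True n m k) =
      - int (ts_entry False (n - 1) m (k - 1))"
    using n mk by (auto simp: ts_entry_rec[OF n])
next
  fix n m k :: nat assume n: "3 \<le> n" and mk: "2 \<le> k + 1 \<and> k + 1 \<le> m \<and> m \<le> n - 1"
  have "{m..n-1} = insert m {m+1..n-1}" using mk by auto
  then show "int (ts_entry True n (m + 1) k) - int (ts_entry True n m k) =
      - int (ts_entry False (n - 1) m k)"
    using n mk by (auto simp: ts_entry_rec[OF n])
next
  fix n m k :: nat assume n: "3 \<le> n" and mk: "2 \<le> k + 1 \<and> k + 1 \<le> m \<and> m \<le> n - 2"
  have "{1..<m+1} = insert m {1..<m}" using mk by auto
  then show "int (ts_entry False n (m + 1) k) - int (ts_entry False n m k) =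
      int (ts_entry True (n - 1) m k)"
    using n mk by (auto simp: ts_entry_rec[OF n])
next
  fix n m k :: nat assume n: "3 \<le> n" and mk: "3 \<le> m + 2 \<and> m + 2 \<le> k \<and> k \<le> n - 1"
  have "{1..<m+1} = insert m {1..<m}" using mk by auto
  then show "int (ts_entry False n (m + 1) k) - int (ts_entry False n m k) =
      int (ts_entry True (n - 1) m (k - 1))"
    using n mk by (auto simp: ts_entry_rec[OF n])
next
  fix n k :: nat assume n: "3 \<le> n" and k: "2 \<le> k \<and> k \<le> n - 1"
  show "ts_entry False n n k = colsum (ts_entry True) (n - 1) (k - 1)"
    and "ts_entry True n 1 k = colsum (ts_entry False) (n - 1) (k - 1)"
    using n k by (auto simp: ts_entry_rec[OF n] colsum_def)
next
  fix n m :: nat assume n: "3 \<le> n" and m: "m \<in> {1..n}"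
  show "ts_entry True n m n = 0" "ts_entry False n m n = 0" "ts_entry True n n m = 0"
      "ts_entry False n 1 m = 0"
    using n m by (auto simp: ts_entry_rec[OF n])
next
  fix n :: nat assume n: "3 \<le> n"
  show "ts_entry False n n 1 = 0"
    using n by (auto simp: ts_entry_rec[OF n])
qed (simp_all add: ts_entry_2)

lemma twin_seidelD:
  assumes "twin_seidel a b" "n \<ge> 3"
  shows "\<And>k. 2 \<le> k \<Longrightarrow> k \<le> n - 1 \<Longrightarrow> b n n k = colsum a (n - 1) (k - 1)"
    and "\<And>k. 1 \<le> k \<Longrightarrow> k \<le> n - 2 \<Longrightarrow> b n (n - 1) k = colsum a (n - 1) k"
    and "\<And>m k. 1 \<le> k \<Longrightarrow> k + 1 \<le> m \<Longrightarrow> m \<le> n - 2 \<Longrightarrow>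
      int (b n (m + 1) k) - int (b n m k) = int (a (n - 1) m k)"
    and "\<And>m k. 1 \<le> m \<Longrightarrow> m + 2 \<le> k \<Longrightarrow> k \<le> n - 1 \<Longrightarrow>
      int (b n (m + 1) k) - int (b n m k) = int (a (n - 1) m (k - 1))"
    and "\<And>k. 2 \<le> k \<Longrightarrow> k \<le> n - 1 \<Longrightarrow> a n 1 k = colsum b (n - 1) (k - 1)"
    and "\<And>m k. 1 \<le> m \<Longrightarrow> m + 2 \<le> k \<Longrightarrow> k \<le> n - 1 \<Longrightarrow>
      int (a n (m + 1) k) - int (a n m k) = - int (b (n - 1) m (k - 1))"
    and "\<And>m k. 1 \<le> k \<Longrightarrow> k + 1 \<le> m \<Longrightarrow> m \<le> n - 1 \<Longrightarrow>
      int (a n (m + 1) k) - int (a n m k) = - int (b (n - 1) m k)"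
proof -
  note T = assms(1)[unfolded twin_seidel_def, THEN conjunct2, THEN conjunct2, THEN conjunct2,
      THEN conjunct2, THEN conjunct2, THEN conjunct2, THEN conjunct2, THEN conjunct2,
      THEN conjunct2, THEN conjunct2]
  note T4 = T[THEN conjunct1, THEN spec, THEN mp, OF assms(2)]
  note T5 = T[THEN conjunct2, THEN spec, THEN mp, OF assms(2)]
  show "2 \<le> k \<Longrightarrow> k \<le> n - 1 \<Longrightarrow> b n n k = colsum a (n - 1) (k - 1)" for k
    using T4[THEN conjunct1] by simp
  show "1 \<le> k \<Longrightarrow> k \<le> n - 2 \<Longrightarrow> b n (n - 1) k = colsum a (n - 1) k" for k
    using T4[THEN conjunct2, THEN conjunct1] by simp
  show "1 \<le> k \<Longrightarrow> k + 1 \<le> m \<Longrightarrow> m \<le> n - 2 \<Longrightarrow>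
      int (b n (m + 1) k) - int (b n m k) = int (a (n - 1) m k)" for m k
    using T4[THEN conjunct2, THEN conjunct2, THEN conjunct1] by simp
  show "1 \<le> m \<Longrightarrow> m + 2 \<le> k \<Longrightarrow> k \<le> n - 1 \<Longrightarrow>
      int (b n (m + 1) k) - int (b n m k) = int (a (n - 1) m (k - 1))" for m k
    using T4[THEN conjunct2, THEN conjunct2, THEN conjunct2] by simp
  show "2 \<le> k \<Longrightarrow> k \<le> n - 1 \<Longrightarrow> a n 1 k = colsum b (n - 1) (k - 1)" for k
    using T5[THEN conjunct1] by simp
  show "1 \<le> m \<Longrightarrow> m + 2 \<le> k \<Longrightarrow> k \<le> n - 1 \<Longrightarrow>
      int (a n (m + 1) k) - int (a n m k) = - int (b (n - 1) m (k - 1))" for m k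
    using T5[THEN conjunct2, THEN conjunct1] by simp
  show "1 \<le> k \<Longrightarrow> k + 1 \<le> m \<Longrightarrow> m \<le> n - 1 \<Longrightarrow>
      int (a n (m + 1) k) - int (a n m k) = - int (b (n - 1) m k)" for m k
    using T5[THEN conjunct2, THEN conjunct2] by simp
qed

lemma twin_seidel_unique:
  assumes ab: "twin_seidel a b" and cd: "twin_seidel c d"
    and "n \<ge> 2" "m \<in> {1..n}" "k \<in> {1..n}"
  shows "a n m k = c n m k \<and> b n m k = d n m k"
  using assms(3-5)
proof (induction n arbitrary: m k rule: less_induct)
  case (less n)
  show ?case
  proof (cases "n = 2")
    case True
    then have "m = 1 \<or> m = 2" "k = 1 \<or> k = 2" using less.prems by auto
    moreover have "a' 2 1 1 = 1 \<and> a' 2 1 2 = 0 \<and> a' 2 2 1 = 0 \<and> a' 2 2 2 = 0 \<and>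
        b' 2 1 1 = 0 \<and> b' 2 1 2 = 0 \<and> b' 2 2 1 = 1 \<and> b' 2 2 2 = 0"
      if "twin_seidel a' b'" for a' b'
      using that unfolding twin_seidel_def by (elim conjE) (intro conjI)
    from this[OF ab] this[OF cd] calculation show ?thesis using True by auto
  next
    case False
    then have n: "n \<ge> 3" using less.prems by simp
    have IH: "a (n-1) i j = c (n-1) i j" "b (n-1) i j = d (n-1) i j"
      if "i \<in> {1..n-1}" "j \<in> {1..n-1}" for i j
      using less.IH[of "n-1" i j] that n by auto
    have cols: "colsum a (n-1) j = colsum c (n-1) j" "colsum b (n-1) j = colsum d (n-1) j"
      if "j \<in> {1..n-1}" for j
      unfolding colsum_def using IH that by (auto intro!: sum.cong)
    have diag: "a n i i = 0 \<and> b n i i = 0 \<and> c n i i = 0 \<and> d n i i = 0" if "i \<in> {1..n}" for i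
      using ab cd n that unfolding twin_seidel_def by auto
    have bdry: "a n i n = 0 \<and> b n i n = 0 \<and> c n i n = 0 \<and> d n i n = 0 \<and>
        a n n i = 0 \<and> b n 1 i = 0 \<and> c n n i = 0 \<and> d n 1 i = 0 \<and> b n n 1 = 0 \<and> d n n 1 = 0"
      if "i \<in> {1..n}" for i
      using ab cd n that unfolding twin_seidel_def by auto
    have sub: "j - 1 \<in> {1..n-1}" if "2 \<le> j" "j \<le> n - 1" for j
      using that unfolding atLeastAtMost_iff by linarith
    have lastr: "b n n j = d n n j" if "2 \<le> j" "j \<le> n - 1" for j
      using twin_seidelD(1)[OF ab n, of j] twin_seidelD(1)[OF cd n, of j] that
        cols(1)[of "j-1"] sub[OF that] by metis
    have lastr': "b n (n-1) j = d n (n-1) j" if "1 \<le> j" "j \<le> n - 2" for j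
      using twin_seidelD(2)[OF ab n, of j] twin_seidelD(2)[OF cd n, of j] that cols(1)[of j] by auto
    have firstr: "a n 1 j = c n 1 j" if "2 \<le> j" "j \<le> n - 1" for j
      using twin_seidelD(5)[OF ab n, of j] twin_seidelD(5)[OF cd n, of j] that
        cols(2)[of "j-1"] sub[OF that] by metis
    have bl: "int (b n (i+1) j) - int (b n i j) = int (d n (i+1) j) - int (d n i j)"
      if "1 \<le> j" "j + 1 \<le> i" "i \<le> n - 2" for i j
    proof -
      have "int (b n (i+1) j) - int (b n i j) = int (a (n-1) i j)"
        "int (d n (i+1) j) - int (d n i j) = int (c (n-1) i j)"
        using twin_seidelD(3)[OF ab n, of j i] twin_seidelD(3)[OF cd n, of j i] that by auto
      then show ?thesis using IH(1)[of i j] that by auto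
    qed
    have bu: "int (b n (i+1) j) - int (b n i j) = int (d n (i+1) j) - int (d n i j)"
      if "1 \<le> i" "i + 2 \<le> j" "j \<le> n - 1" for i j
    proof -
      have "int (b n (i+1) j) - int (b n i j) = int (a (n-1) i (j-1))"
        "int (d n (i+1) j) - int (d n i j) = int (c (n-1) i (j-1))"
        using twin_seidelD(4)[OF ab n, of i j] twin_seidelD(4)[OF cd n, of i j] that by auto
      moreover have "2 \<le> j" "i \<in> {1..n-1}" using that by auto
      ultimately show ?thesis using IH(1)[of i "j-1"] sub[of j] that by metis
    qed
    have al: "int (a n (i+1) j) - int (a n i j) = int (c n (i+1) j) - int (c n i j)"
      if "1 \<le> j" "j + 1 \<le> i" "i \<le> n - 1" for i j
    proof -
      have "int (a n (i+1) j) - int (a n i j) = - int (b (n-1) i j)"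
        "int (c n (i+1) j) - int (c n i j) = - int (d (n-1) i j)"
        using twin_seidelD(7)[OF ab n, of j i] twin_seidelD(7)[OF cd n, of j i] that by auto
      then show ?thesis using IH(2)[of i j] that by auto
    qed
    have au: "int (a n (i+1) j) - int (a n i j) = int (c n (i+1) j) - int (c n i j)"
      if "1 \<le> i" "i + 2 \<le> j" "j \<le> n - 1" for i j
    proof -
      have "int (a n (i+1) j) - int (a n i j) = - int (b (n-1) i (j-1))"
        "int (c n (i+1) j) - int (c n i j) = - int (d (n-1) i (j-1))"
        using twin_seidelD(6)[OF ab n, of i j] twin_seidelD(6)[OF cd n, of i j] that by auto
      moreover have "2 \<le> j" "i \<in> {1..n-1}" using that by auto
      ultimately show ?thesis using IH(2)[of i "j-1"] sub[of j] that by metis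
    qed
    consider "k = n" | "m = k" | "m < k" "k \<le> n - 1" | "k < m" "m = n" | "k < m" "m \<le> n - 1"
      using less.prems by fastforce
    then show ?thesis
    proof cases
      case 1 then show ?thesis using bdry less.prems by auto
    next
      case 2 then show ?thesis using diag less.prems by auto
    next
      case 3
      have "1 \<le> m" using less.prems by simp
      then have "m < k \<longrightarrow> a n m k = c n m k \<and> b n m k = d n m k"
      proof (induction m rule: dec_induct)
        case base
        then show ?case using firstr[of k] bdry[of k] 3 by auto
      next
        case (step i)
        then show ?case using au[of i k] bu[of i k] 3 by auto
      qed
      then show ?thesis using 3 by simp
    next
      case 4
      then show ?thesis
        using lastr[of k] bdry[of k] less.prems by (cases "k = 1") auto
    next
      case 5
      have "a n m k = c n m k"
      proof -
        have "m \<le> n" using 5 by simp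
        then have "k < m \<longrightarrow> a n m k = c n m k"
        proof (induction m rule: inc_induct)
          case base
          then show ?case using bdry[of k] less.prems by auto
        next
          case (step i)
          then show ?case using al[of k i] less.prems by auto
        qed
        then show ?thesis using 5 by simp
      qed
      moreover have "b n m k = d n m k"
      proof -
        have "k < m \<longrightarrow> b n m k = d n m k" using \<open>m \<le> n - 1\<close>
        proof (induction m rule: inc_induct)
          case base
          then show ?case using lastr'[of k] less.prems by auto
        next
          case (step i)
          then show ?case using bl[of k i] less.prems by auto
        qed
        then show ?thesis using 5 by simp
      qed
      ultimately show ?thesis by simp
    qed
  qed
qed

text \<open>
  Well-definedness of substitution: only the powers up to the total degree contribute to a
  coefficient.  Division by a series with nonzero constant term is the division of the ring.
\<close>

lemma coeff3_mult:
  "coeff3 (f * g) i j l =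
     (\<Sum>l'=0..l. \<Sum>j'=0..j. \<Sum>i'=0..i. coeff3 f i' j' l' * coeff3 g (i - i') (j - j') (l - l'))"
  unfolding coeff3_def by (simp add: fps_mult_nth fps_sum_nth)

lemma coeff3_const_mult: "coeff3 (const3 c * f) i j l = c * coeff3 f i j l"
  by (simp add: coeff3_def const3_def)

lemma coeff3_power_eq_0:
  assumes "coeff3 u 0 0 0 = 0" "i + j + l < n"
  shows "coeff3 (u ^ n) i j l = 0"
  using assms(2)
proof (induction n arbitrary: i j l)
  case (Suc n)
  have "coeff3 u i' j' l' * coeff3 (u ^ n) (i - i') (j - j') (l - l') = 0"
    if "i' \<le> i" "j' \<le> j" "l' \<le> l" for i' j' l'
  proof (cases "i' = 0 \<and> j' = 0 \<and> l' = 0")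
    case True
    then show ?thesis using assms(1) by simp
  next
    case False
    then have "(i - i') + (j - j') + (l - l') < n" using that Suc.prems by linarith
    then show ?thesis using Suc.IH by simp
  qed
  then show ?case
    unfolding power_Suc coeff3_mult by (intro sum.neutral ballI) simp
qed simp

lemma coeff3_subst3:
  assumes "coeff3 u 0 0 0 = 0"
  shows "coeff3 (subst3 f u) i j l = (\<Sum>n\<le>i+j+l. fps_nth f n * coeff3 (u ^ n) i j l)"
proof -
  have "coeff3 (subst3 f u) i j l =
      (\<Sum>n | fps_nth f n * coeff3 (u ^ n) i j l \<noteq> 0. fps_nth f n * coeff3 (u ^ n) i j l)"
    unfolding subst3_def formal_sum_def
    by (subst coeff3_def) (simp add: coeff3_const_mult)
  also have "\<dots> = (\<Sum>n\<le>i+j+l. fps_nth f n * coeff3 (u ^ n) i j l)"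
    using coeff3_power_eq_0[OF assms]
    by (intro sum.mono_neutral_left) (auto simp: not_less[symmetric])
  finally show ?thesis .
qed

lemma fps_inverse_right_unit:
  fixes g :: "'a :: {comm_ring_1, inverse} fps"
  assumes "fps_nth g 0 * inverse (fps_nth g 0) = 1"
  shows "g * inverse g = 1"
  using fps_right_inverse[OF assms] by (simp add: fps_inverse_def)

lemma divide3_mult_cancel:
  fixes f g :: fps3
  assumes "coeff3 g 0 0 0 \<noteq> 0"
  shows "f / g * g = f"
proof -
  have *: "g * inverse g = 1"
    using assms unfolding coeff3_def by (intro fps_inverse_right_unit) auto
  have "fps_nth g 0 \<noteq> 0" using assms by (auto simp: coeff3_def)
  then have "subdegree g = 0" by simp
  then have "f / g = f * inverse g" by (simp add: fps_divide_def)
  then show ?thesis using * by (simp add: mult.assoc mult.commute)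
qed

end

theory Submission
  imports Defs
begin

text \<open>
  Number the entries above the diagonal of \<open>A\<^sub>N\<close> and \<open>B\<^sub>N\<close> by the exponents (i, j, l) of their
  monomials, i + j + l = N - 3, and likewise below the diagonal.  Inside each triangle the difference
  equations become \<open>\<delta>B = A\<close>, \<open>\<delta>A = -B\<close> (above) and \<open>\<delta>A = B\<close>, \<open>\<delta>B = -A\<close> (below) for the generating
  functions, where \<open>\<delta> = \<partial>\<^sub>x - \<partial>\<^sub>y\<close>.  The same equations make the column sums telescope, so that the
  conditions on column sums reduce to a symmetry across the diagonal: the two triangles agree
  along y = 0 after exchanging x and z, except for a constant 1 in the case of B.  With the
  boundary values these relations form a linear recursion in the total degree, which has only one
  solution, and the closed forms satisfy it by the addition theorems.
\<close>

section \<open>The recursion for the entries\<close>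

text \<open>The arguments are the exponents of x, y, z. The first four clauses are the difference
  equations; each joins two neighbours of one degree to an entry of the degree below. Then come the
  zero top row of B, the row of A next to its last one (i = 0 below the diagonal) in two clauses,
  and the symmetry across the diagonal.\<close>

definition seidel_system ::
  "(nat \<Rightarrow> nat \<Rightarrow> nat \<Rightarrow> real) \<Rightarrow> (nat \<Rightarrow> nat \<Rightarrow> nat \<Rightarrow> real) \<Rightarrow>
   (nat \<Rightarrow> nat \<Rightarrow> nat \<Rightarrow> real) \<Rightarrow> (nat \<Rightarrow> nat \<Rightarrow> nat \<Rightarrow> real) \<Rightarrow> bool" where
  "seidel_system AU BU AL BL \<longleftrightarrow>
    (\<forall>i j l. BU (Suc i) j l = BU i (Suc j) l + AU i j l) \<and>
    (\<forall>i j l. AU i (Suc j) l = AU (Suc i) j l + BU i j l) \<and>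
    (\<forall>i j l. BL i (Suc j) l = BL (Suc i) j l + AL i j l) \<and>
    (\<forall>i j l. AL (Suc i) j l = AL i (Suc j) l + BL i j l) \<and>
    (\<forall>j l. BU 0 j l = 0) \<and>
    (\<forall>j. AL 0 j 0 = 0) \<and>
    (\<forall>j l. AL 0 j (Suc l) = BL 0 j l) \<and>
    (\<forall>p l. AU p 0 l = AL l 0 p) \<and>
    (\<forall>p l. BL l 0 p = BU p 0 l + (if l = 0 \<and> p = 0 then 1 else 0))"

text \<open>Induction on the total degree. Modulo lower degree, a difference equation carries a
  value along i + j = const, so one face determines each family. The order matters:
  \<open>AL\<close> starts at i = 0 from 0 or from \<open>BL\<close> in lower degree,
  \<open>BU\<close> starts from 0, and only then does the symmetry supply the faces j = 0 of
  \<open>AU\<close> and \<open>BL\<close>.\<close>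

lemma seidel_system_unique:
  assumes "seidel_system AU BU AL BL" "seidel_system AU' BU' AL' BL'"
  shows "AU i j l = AU' i j l \<and> BU i j l = BU' i j l \<and> AL i j l = AL' i j l \<and> BL i j l = BL' i j l"
proof (induction "i + j + l" arbitrary: i j l rule: less_induct)
  case less
  note S = assms(1)[unfolded seidel_system_def] and S' = assms(2)[unfolded seidel_system_def]
  define d where "d = i + j + l"
  have IH: "AU i j l = AU' i j l" "BU i j l = BU' i j l" "AL i j l = AL' i j l" "BL i j l = BL' i j l"
    if "i + j + l < d" for i j l
    using less that unfolding d_def by blast+
  have AL: "AL i j l = AL' i j l" if "i + j + l = d" for i j l
    using that
  proof (induction i arbitrary: j)
    case 0
    then show ?case using S S' IH(4)[of 0 j "l - 1"] by (cases l) auto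
  next
    case (Suc i)
    then show ?case using S S' IH(4)[of i j l] Suc.IH[of "Suc j"] by auto
  qed
  have BU: "BU i j l = BU' i j l" if "i + j + l = d" for i j l
    using that
  proof (induction i arbitrary: j)
    case 0
    then show ?case using S S' by auto
  next
    case (Suc i)
    then show ?case using S S' IH(1)[of i j l] Suc.IH[of "Suc j"] by auto
  qed
  have AU: "AU i j l = AU' i j l" if "i + j + l = d" for i j l
    using that
  proof (induction j arbitrary: i)
    case 0
    then show ?case using S S' AL[of l 0 i] by auto
  next
    case (Suc j)
    then show ?case using S S' IH(2)[of i j l] Suc.IH[of "Suc i"] by auto
  qed
  have BL: "BL i j l = BL' i j l" if "i + j + l = d" for i j l
    using that
  proof (induction j arbitrary: i)
    case 0
    then show ?case using S S' BU[of l 0 i] by auto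
  next
    case (Suc j)
    then show ?case using S S' IH(3)[of i j l] Suc.IH[of "Suc i"] by auto
  qed
  show ?case using AU BU AL BL d_def by simp
qed

text \<open>
  Only the matrices \<open>A\<^sub>N\<close> with N even and \<open>B\<^sub>N\<close> with N odd interact, so the flag selects the
  parity of N and the other entries are set to 0.
\<close>

definition upper_entries :: "bool \<Rightarrow> (nat \<Rightarrow> nat \<Rightarrow> nat \<Rightarrow> nat) \<Rightarrow> nat \<Rightarrow> nat \<Rightarrow> nat \<Rightarrow> real" where
  "upper_entries e c i j l =
     (if odd (i + j + l) = e then real (c (i + j + l + 3) (i + 1) (i + j + 2)) else 0)"

definition lower_entries :: "bool \<Rightarrow> (nat \<Rightarrow> nat \<Rightarrow> nat \<Rightarrow> nat) \<Rightarrow> nat \<Rightarrow> nat \<Rightarrow> nat \<Rightarrow> real" where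
  "lower_entries e c i j l =
     (if odd (i + j + l) = e then real (c (i + j + l + 3) (j + l + 2) (l + 1)) else 0)"

section \<open>Column sums, telescoping and the symmetry across the diagonal\<close>

lemma colsum_split:
  "colsum c (p + l + 2) (p + 1) =
     (\<Sum>m = 1..<p+1. c (p + l + 2) m (p + 1)) + c (p + l + 2) (p + 1) (p + 1) +
     (\<Sum>m = p+2..<p+l+2. c (p + l + 2) m (p + 1)) + c (p + l + 2) (p + l + 2) (p + 1)"
proof -
  have "{1..p+l+2} = {1..<p+1} \<union> {p+1} \<union> {p+2..<p+l+2} \<union> {p+l+2}" by auto
  then show ?thesis
    unfolding colsum_def by (simp add: sum.union_disjoint)
qed

lemma add_3_eq_Suc: "n + 3 = Suc (Suc (Suc n))"
  and add_4_eq_Suc: "n + 4 = Suc (Suc (Suc (Suc n)))"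
  by simp_all

lemma real_diff_eq:
  assumes "int x - int y = int z" shows "real z = real x - real y"
  using assms by (metis of_int_diff of_int_of_nat_eq)

lemma real_diff_eq_neg:
  assumes "int x - int y = - int z" shows "real z = real y - real x"
  using assms by (intro real_diff_eq) linarith

context
  fixes a b :: "nat \<Rightarrow> nat \<Rightarrow> nat \<Rightarrow> nat"
  assumes twin: "twin_seidel a b"
begin

lemma twin_seidel_zeros:
  assumes "n \<ge> 3"
  shows "i \<in> {1..n} \<Longrightarrow> a n i i = 0" "i \<in> {1..n} \<Longrightarrow> b n i i = 0"
    "k \<in> {1..n} \<Longrightarrow> a n n k = 0" "k \<in> {1..n} \<Longrightarrow> b n 1 k = 0" "b n n 1 = 0"
  using twin assms unfolding twin_seidel_def by auto

lemma twin_seidel_base: "a 2 (Suc 0) (Suc 0) = 1" "a 2 2 (Suc 0) = 0"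
proof -
  have "a 2 1 1 = 1 \<and> a 2 2 1 = 0"
    using twin unfolding twin_seidel_def by (elim conjE) (intro conjI)
  then show "a 2 (Suc 0) (Suc 0) = 1" "a 2 2 (Suc 0) = 0" by simp_all
qed

text \<open>Column p + 1 of the smaller A consists of differences of B and telescopes on both sides
  of the diagonal. The bottom value of the lower telescope, in row p + l + 2 of B, is itself the
  column sum and cancels. The extra 1 is the entry 1 of the initial matrix, the only nonzero
  diagonal entry.\<close>

lemma diagonal_match_b:
  "real (b (p + l + 3) (p + 2) (p + 1)) =
     real (b (p + l + 3) (p + 1) (p + 2)) + (if l = 0 \<and> p = 0 then 1 else 0)"
proof -
  let ?N = "p + l + 2" and ?n = "p + l + 3"
  have u: "real (a ?N m (p+1)) = real (b ?n (m+1) (p+2)) - real (b ?n m (p+2))"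
    if "m \<in> {1..<p+1}" for m
    using that twin_seidelD(4)[OF twin, of ?n m "p+2"] by (intro real_diff_eq) auto
  have lo: "real (a ?N m (p+1)) = real (b ?n (m+1) (p+1)) - real (b ?n m (p+1))"
    if "m \<in> {p+2..<p+l+2}" for m
    using that twin_seidelD(3)[OF twin, of ?n "p+1" m] by (intro real_diff_eq) auto
  have "(\<Sum>m = 1..<p+1. real (a ?N m (p+1))) =
      (\<Sum>m = 1..<p+1. real (b ?n (Suc m) (p+2)) - real (b ?n m (p+2)))"
    using u by (intro sum.cong) auto
  also have "\<dots> = real (b ?n (p+1) (p+2)) - real (b ?n 1 (p+2))"
    by (subst sum_Suc_diff') auto
  also have "b ?n 1 (p+2) = 0" using twin_seidel_zeros(4)[of ?n "p+2"] by auto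
  finally have 1: "(\<Sum>m = 1..<p+1. real (a ?N m (p+1))) = real (b ?n (p+1) (p+2))" by simp
  have "(\<Sum>m = p+2..<p+l+2. real (a ?N m (p+1))) =
      (\<Sum>m = p+2..<p+l+2. real (b ?n (Suc m) (p+1)) - real (b ?n m (p+1)))"
    using lo by (intro sum.cong) auto
  also have "\<dots> = real (b ?n (p+l+2) (p+1)) - real (b ?n (p+2) (p+1))"
    by (subst sum_Suc_diff') auto
  finally have 2: "(\<Sum>m = p+2..<p+l+2. real (a ?N m (p+1))) =
      real (b ?n (p+l+2) (p+1)) - real (b ?n (p+2) (p+1))" .
  have 3: "real (a ?N (p+1) (p+1)) = (if l = 0 \<and> p = 0 then 1 else 0)"
  proof (cases "l = 0 \<and> p = 0")
    case True
    then show ?thesis using twin_seidel_base(1) by (simp add: numeral_2_eq_2)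
  next
    case False
    then show ?thesis using twin_seidel_zeros(1)[of ?N "p+1"] by auto
  qed
  have 4: "real (a ?N ?N (p+1)) = 0"
  proof (cases "l = 0 \<and> p = 0")
    case True
    then show ?thesis using twin_seidel_base(2) by (simp add: numeral_2_eq_2)
  next
    case False
    then show ?thesis using twin_seidel_zeros(3)[of ?N "p+1"] by auto
  qed
  have "b ?n (?n - 1) (p+1) = colsum a (?n - 1) (p+1)"
    by (rule twin_seidelD(2)[OF twin]) auto
  then have "b ?n (p+l+2) (p+1) = colsum a ?N (p+1)" by (simp add: numeral_3_eq_3 numeral_2_eq_2)
  then have "real (b ?n (p+l+2) (p+1)) = real (\<Sum>m = 1..<p+1. a ?N m (p+1)) + real (a ?N (p+1) (p+1)) +
      real (\<Sum>m = p+2..<p+l+2. a ?N m (p+1)) + real (a ?N ?N (p+1))"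
    unfolding colsum_split by linarith
  then show ?thesis using 1 2 3 4 unfolding of_nat_sum by linarith
qed

text \<open>The same telescoping with A and B exchanged; now the top row of A supplies the column
  sum of B.\<close>

lemma diagonal_match_a:
  assumes "p + l \<ge> 1"
  shows "a (p + l + 3) (p + 1) (p + 2) = a (p + l + 3) (p + 2) (p + 1)"
proof -
  let ?N = "p + l + 2" and ?n = "p + l + 3"
  have u: "real (b ?N m (p+1)) = real (a ?n m (p+2)) - real (a ?n (m+1) (p+2))"
    if "m \<in> {1..<p+1}" for m
    using that twin_seidelD(6)[OF twin, of ?n m "p+2"] by (intro real_diff_eq_neg) auto
  \<comment> \<open>The range includes row \<open>?N\<close>, one more than is summed below: as the
    last row of A is zero, this extra equation evaluates the bottom entry of the column of
    B.\<close>
  have lo: "real (b ?N m (p+1)) = real (a ?n m (p+1)) - real (a ?n (m+1) (p+1))"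
    if "m \<in> {p+2..<p+l+3}" for m
    using that twin_seidelD(7)[OF twin, of ?n "p+1" m] by (intro real_diff_eq_neg) auto
  have "(\<Sum>m = 1..<p+1. real (b ?N m (p+1))) =
      - (\<Sum>m = 1..<p+1. real (a ?n (Suc m) (p+2)) - real (a ?n m (p+2)))"
    unfolding sum_negf[symmetric] using u by (intro sum.cong) auto
  also have "\<dots> = real (a ?n 1 (p+2)) - real (a ?n (p+1) (p+2))"
    by (subst sum_Suc_diff') auto
  finally have 1: "(\<Sum>m = 1..<p+1. real (b ?N m (p+1))) = real (a ?n 1 (p+2)) - real (a ?n (p+1) (p+2))" .
  have "(\<Sum>m = p+2..<p+l+2. real (b ?N m (p+1))) =
      - (\<Sum>m = p+2..<p+l+2. real (a ?n (Suc m) (p+1)) - real (a ?n m (p+1)))"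
    unfolding sum_negf[symmetric] using lo by (intro sum.cong) auto
  also have "\<dots> = real (a ?n (p+2) (p+1)) - real (a ?n (p+l+2) (p+1))"
    by (subst sum_Suc_diff') auto
  finally have 2: "(\<Sum>m = p+2..<p+l+2. real (b ?N m (p+1))) =
      real (a ?n (p+2) (p+1)) - real (a ?n (p+l+2) (p+1))" .
  have 3: "real (b ?N (p+1) (p+1)) = 0"
    using twin_seidel_zeros(2)[of ?N "p+1"] assms by auto
  have "a ?n (p+l+2+1) (p+1) = 0"
    using twin_seidel_zeros(3)[of ?n "p+1"] by (auto simp: numeral_3_eq_3)
  then have 4: "real (b ?N ?N (p+1)) = real (a ?n (p+l+2) (p+1))"
    using lo[of ?N] by simp
  have "a ?n 1 (p+2) = colsum b (?n - 1) (p+2-1)"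
    by (rule twin_seidelD(5)[OF twin]) auto
  then have "a ?n 1 (p+2) = colsum b ?N (p+1)" by (simp add: numeral_3_eq_3 numeral_2_eq_2)
  then have "real (a ?n 1 (p+2)) = real (\<Sum>m = 1..<p+1. b ?N m (p+1)) + real (b ?N (p+1) (p+1)) +
      real (\<Sum>m = p+2..<p+l+2. b ?N m (p+1)) + real (b ?N ?N (p+1))"
    unfolding colsum_split by linarith
  then show ?thesis using 1 2 3 4 unfolding of_nat_sum by linarith
qed

text \<open>The last row of A is zero, so the last difference equation evaluates the row above
  it.\<close>

lemma penultimate_row_a:
  assumes "n \<ge> 4" "k \<in> {1..n-2}"
  shows "a n (n - 1) k = b (n - 1) (n - 1) k"
proof -
  have "int (a n (n - 1 + 1) k) - int (a n (n - 1) k) = - int (b (n - 1) (n - 1) k)"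
    using assms by (intro twin_seidelD(7)[OF twin]) auto
  then show ?thesis using twin_seidel_zeros(3)[of n k] assms by auto
qed

lemma twin_seidel_system:
  "seidel_system (upper_entries True a) (upper_entries False b)
     (lower_entries True a) (lower_entries False b)"
  unfolding seidel_system_def
proof (intro conjI allI)
  fix i j l :: nat
  \<comment> \<open>The larger matrix has size \<open>?n\<close>, the smaller one
    \<open>?n - 1\<close>. Degree and family change together, so either all three terms of an
    equation pass the parity flag or none does.\<close>
  let ?n = "i + j + l + 4"
  show "upper_entries False b (Suc i) j l = upper_entries False b i (Suc j) l + upper_entries True a i j l"
    using real_diff_eq[OF twin_seidelD(4)[OF twin, of ?n "i+1" "i+j+3"]]
    by (simp add: upper_entries_def add_3_eq_Suc add_4_eq_Suc)
  show "upper_entries True a i (Suc j) l = upper_entries True a (Suc i) j l + upper_entries False b i j l"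
    using real_diff_eq_neg[OF twin_seidelD(6)[OF twin, of ?n "i+1" "i+j+3"]]
    by (simp add: upper_entries_def add_3_eq_Suc add_4_eq_Suc)
  show "lower_entries False b i (Suc j) l = lower_entries False b (Suc i) j l + lower_entries True a i j l"
    using real_diff_eq[OF twin_seidelD(3)[OF twin, of ?n "l+1" "j+l+2"]]
    by (simp add: lower_entries_def add_3_eq_Suc add_4_eq_Suc)
  show "lower_entries True a (Suc i) j l = lower_entries True a i (Suc j) l + lower_entries False b i j l"
    using real_diff_eq_neg[OF twin_seidelD(7)[OF twin, of ?n "l+1" "j+l+2"]]
    by (simp add: lower_entries_def add_3_eq_Suc add_4_eq_Suc)
next
  fix j l :: nat
  show "upper_entries False b 0 j l = 0"
    using twin_seidel_zeros(4)[of "j+l+3" "j+2"] by (auto simp: upper_entries_def)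
next
  fix j :: nat
  show "lower_entries True a 0 j 0 = 0"
    using penultimate_row_a[of "j+3" 1] twin_seidel_zeros(5)[of "j+2"]
    by (cases "j = 0") (auto simp: lower_entries_def add_3_eq_Suc add_4_eq_Suc)
next
  fix j l :: nat
  \<comment> \<open>The last two rows of B list the same column sums of A, shifted by one column;
    hence l drops by one.\<close>
  have "a (j+l+4) (j+l+3) (l+2) = b (j+l+3) (j+l+3) (l+2)"
    using penultimate_row_a[of "j+l+4" "l+2"] by (simp add: add_3_eq_Suc add_4_eq_Suc)
  also have "\<dots> = colsum a (j+l+2) (l+1)"
    using twin_seidelD(1)[OF twin, of "j+l+3" "l+2"] by (simp add: add_3_eq_Suc add_4_eq_Suc)
  also have "\<dots> = b (j+l+3) (j+l+2) (l+1)"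
    using twin_seidelD(2)[OF twin, of "j+l+3" "l+1"] by (simp add: add_3_eq_Suc add_4_eq_Suc)
  finally show "lower_entries True a 0 j (Suc l) = lower_entries False b 0 j l"
    by (simp add: lower_entries_def add_3_eq_Suc add_4_eq_Suc)
next
  fix p l :: nat
  have "odd (p + l) \<Longrightarrow> p + l \<ge> 1" by (cases "p + l") auto
  then show "upper_entries True a p 0 l = lower_entries True a l 0 p"
    using diagonal_match_a[of p l] by (auto simp: upper_entries_def lower_entries_def ac_simps)
  show "lower_entries False b l 0 p = upper_entries False b p 0 l + (if l = 0 \<and> p = 0 then 1 else 0)"
    using diagonal_match_b[of p l] by (auto simp: upper_entries_def lower_entries_def ac_simps)
qed

end

section \<open>Derivations and trigonometric series in three variables\<close>

lemma fps3_eqI: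
  assumes "\<And>i j l. coeff3 f i j l = coeff3 g i j l"
  shows "f = g"
  using assms unfolding coeff3_def by (intro fps_ext) auto

lemma coeff3_simps [simp]:
  "coeff3 (f + g) i j l = coeff3 f i j l + coeff3 g i j l"
  "coeff3 (f - g) i j l = coeff3 f i j l - coeff3 g i j l"
  "coeff3 (- f) i j l = - coeff3 f i j l"
  "coeff3 0 i j l = 0"
  "coeff3 1 i j l = (if i = 0 \<and> j = 0 \<and> l = 0 then 1 else 0)"
  by (auto simp: coeff3_def)

lemma coeff3_vars:
  "coeff3 X3 i j l = (if i = 1 \<and> j = 0 \<and> l = 0 then 1 else 0)"
  "coeff3 Y3 i j l = (if i = 0 \<and> j = 1 \<and> l = 0 then 1 else 0)"
  "coeff3 Z3 i j l = (if i = 0 \<and> j = 0 \<and> l = 1 then 1 else 0)"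
  by (auto simp: coeff3_def X3_def Y3_def Z3_def fps_X_def)

lemma const3_simps [simp]: "const3 0 = 0" "const3 1 = 1"
  by (simp_all add: const3_def)

text \<open>Covers the three partial derivatives and also their difference \<delta>. The ring is
  arbitrary so that derivations can be lifted through the nested series rings.\<close>

locale derivation =
  fixes d :: "'a::comm_ring_1 \<Rightarrow> 'a"
  assumes add: "d (x + y) = d x + d y"
    and mult: "d (x * y) = d x * y + x * d y"
begin

lemma zero: "d 0 = 0"
  using add[of 0 0] by simp

lemma one: "d 1 = 0"
  using mult[of 1 1] by simp

lemma uminus: "d (- x) = - d x"
  using add[of x "- x"] zero by (simp add: eq_neg_iff_add_eq_0 add.commute)

lemma diff: "d (x - y) = d x - d y"
  using add[of x "- y"] uminus by simp

lemma sum: "d (\<Sum>i\<in>I. f i) = (\<Sum>i\<in>I. d (f i))"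
  by (induction I rule: infinite_finite_induct) (auto simp: zero add)

lemma power: "d (x ^ n) = of_nat n * x ^ (n - 1) * d x"
proof (induction n)
  case (Suc n)
  then show ?case by (cases n) (auto simp: mult algebra_simps one)
qed (simp add: one)

text \<open>The quotient rule for 1/c without division: differentiate t c = 1 and multiply by
  t.\<close>

lemma unit_inverse:
  assumes "t * c = 1"
  shows "d t = - (t * t * d c)"
proof -
  have "d t * c + t * d c = 0" using mult[of t c] assms one by simp
  then have "t * (d t * c + t * d c) = 0" by simp
  moreover have "t * (d t * c + t * d c) = d t * (t * c) + t * t * d c"
    by (simp add: algebra_simps)
  ultimately show ?thesis using assms by (simp add: eq_neg_iff_add_eq_0)
qed

lemma diff_derivation:
  assumes "derivation d'"
  shows "derivation (\<lambda>x. d x - d' x)"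
proof -
  interpret d': derivation d' by fact
  show ?thesis
    by unfold_locales (simp_all add: add mult d'.add d'.mult algebra_simps)
qed

text \<open>Acting on coefficients treats the new outer variable as a constant; the product rule
  survives because the Cauchy product is bilinear.\<close>

lemma lift_fps: "derivation (\<lambda>f. Abs_fps (\<lambda>n. d (fps_nth f n)))"
  by unfold_locales
     (auto simp: fps_eq_iff add fps_mult_nth sum mult sum.distrib)

end

lemma derivation_fps_deriv: "derivation (fps_deriv :: 'a::comm_ring_1 fps \<Rightarrow> 'a fps)"
  by unfold_locales (simp_all add: algebra_simps)

definition DX :: "fps3 \<Rightarrow> fps3" where
  "DX f = Abs_fps (\<lambda>l. Abs_fps (\<lambda>j. fps_deriv (fps_nth (fps_nth f l) j)))"
definition DY :: "fps3 \<Rightarrow> fps3" where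
  "DY f = Abs_fps (\<lambda>l. fps_deriv (fps_nth f l))"
definition DZ :: "fps3 \<Rightarrow> fps3" where
  "DZ = fps_deriv"

interpretation DX: derivation DX
  unfolding DX_def [abs_def]
  by (rule derivation.lift_fps[OF derivation.lift_fps[OF derivation_fps_deriv]])

interpretation DY: derivation DY
  unfolding DY_def [abs_def]
  by (rule derivation.lift_fps[OF derivation_fps_deriv])

interpretation DZ: derivation DZ
  unfolding DZ_def by (rule derivation_fps_deriv)

lemma coeff3_deriv:
  "coeff3 (DX f) i j l = real (Suc i) * coeff3 f (Suc i) j l"
  "coeff3 (DY f) i j l = real (Suc j) * coeff3 f i (Suc j) l"
  "coeff3 (DZ f) i j l = real (Suc l) * coeff3 f i j (Suc l)"
proof -
  have *: "fps_nth (of_nat n * g) k = of_nat n * fps_nth g k"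
    for n k and g :: "'a::comm_ring_1 fps"
    by (simp add: fps_of_nat[symmetric] del: fps_of_nat)
  show "coeff3 (DX f) i j l = real (Suc i) * coeff3 f (Suc i) j l"
    by (simp add: coeff3_def DX_def)
  show "coeff3 (DY f) i j l = real (Suc j) * coeff3 f i (Suc j) l"
    unfolding coeff3_def DY_def by (simp add: * del: of_nat_Suc)
  show "coeff3 (DZ f) i j l = real (Suc l) * coeff3 f i j (Suc l)"
    unfolding coeff3_def DZ_def by (simp add: * del: of_nat_Suc)
qed

lemma deriv_vars [simp]:
  "DX X3 = 1" "DX Y3 = 0" "DX Z3 = 0"
  "DY X3 = 0" "DY Y3 = 1" "DY Z3 = 0"
  "DZ X3 = 0" "DZ Y3 = 0" "DZ Z3 = 1"
  by (rule fps3_eqI, simp add: coeff3_deriv coeff3_vars)+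

text \<open>Every nonconstant coefficient occurs, with a nonzero factor, in one of the three
  derivatives. The trigonometric identities below are proved this way.\<close>

lemma fps3_deriv_zero_imp_zero:
  assumes "DX f = 0" "DY f = 0" "DZ f = 0" "coeff3 f 0 0 0 = 0"
  shows "f = 0"
proof (rule fps3_eqI)
  fix i j l
  have "coeff3 f (Suc i) j l = 0" "coeff3 f i (Suc j) l = 0" "coeff3 f i j (Suc l) = 0" for i j l
    using coeff3_deriv[of f i j l] assms by auto
  then show "coeff3 f i j l = coeff3 0 i j l"
    using assms(4) by (cases i; cases j; cases l) auto
qed

text \<open>The chain rule for an argument with constant derivative, proved coefficientwise because
  each coefficient of a substitution is a finite sum.\<close>

lemma deriv_subst3:
  assumes u: "coeff3 u 0 0 0 = 0"
  shows "DX u = const3 c \<Longrightarrow> DX (subst3 f u) = const3 c * subst3 (fps_deriv f) u"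
    and "DY u = const3 c \<Longrightarrow> DY (subst3 f u) = const3 c * subst3 (fps_deriv f) u"
    and "DZ u = const3 c \<Longrightarrow> DZ (subst3 f u) = const3 c * subst3 (fps_deriv f) u"
proof -
  \<comment> \<open>One argument serves all three variables: it only uses that \<open>d\<close>
    reads off, up to a factor, a single coefficient of total degree one higher.\<close>
  have *: "d (subst3 f u) = const3 c * subst3 (fps_deriv f) u"
    if "derivation d" and du: "d u = const3 c"
      and co: "\<And>i j l. \<exists>w i' j' l'. i' + j' + l' = Suc (i + j + l) \<and>
                 (\<forall>h. coeff3 (d h) i j l = w * coeff3 h i' j' l')" for d
  proof (rule fps3_eqI)
    fix i j l
    interpret derivation d by fact
    obtain w i' j' l' where s: "i' + j' + l' = Suc (i + j + l)"
      and w: "\<And>h. coeff3 (d h) i j l = w * coeff3 h i' j' l'"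
      using co by meson
    have n: "of_nat n = const3 (real n)" for n
      by (simp add: const3_def fps_of_nat)
    have p: "coeff3 (d (u ^ n)) i j l = real n * (c * coeff3 (u ^ (n - 1)) i j l)" for n
    proof -
      have "d (u ^ n) = const3 (real n) * (const3 c * u ^ (n - 1))"
        by (simp add: power du n mult_ac)
      then show ?thesis by (simp only: coeff3_const_mult)
    qed
    have "coeff3 (d (subst3 f u)) i j l = (\<Sum>n\<le>Suc (i + j + l). fps_nth f n * coeff3 (d (u ^ n)) i j l)"
      by (simp only: w coeff3_subst3[OF u] s sum_distrib_left mult.left_commute)
    \<comment> \<open>The term n = 0 vanishes since \<open>d 1 = 0\<close>; the shift restores the
      summation range belonging to degree i + j + l.\<close>
    also have "\<dots> = (\<Sum>n\<le>i + j + l. fps_nth f (Suc n) * coeff3 (d (u ^ Suc n)) i j l)"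
      by (subst sum.atMost_Suc_shift) (simp add: one)
    also have "\<dots> = c * (\<Sum>n\<le>i + j + l. fps_nth (fps_deriv f) n * coeff3 (u ^ n) i j l)"
      unfolding sum_distrib_left by (intro sum.cong refl, subst p) (simp add: algebra_simps)
    also have "\<dots> = coeff3 (const3 c * subst3 (fps_deriv f) u) i j l"
      by (simp only: coeff3_const_mult coeff3_subst3[OF u])
    finally show "coeff3 (d (subst3 f u)) i j l = coeff3 (const3 c * subst3 (fps_deriv f) u) i j l" .
  qed
  show "DX u = const3 c \<Longrightarrow> DX (subst3 f u) = const3 c * subst3 (fps_deriv f) u"
  proof (rule *[OF DX.derivation_axioms])
    show "\<exists>w i' j' l'. i' + j' + l' = Suc (i + j + l) \<and>
        (\<forall>h. coeff3 (DX h) i j l = w * coeff3 h i' j' l')" for i j l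
      by (rule exI[of _ "real (Suc i)"], rule exI[of _ "Suc i"], rule exI[of _ "j"],
          rule exI[of _ "l"]) (simp add: coeff3_deriv)
  qed
  show "DY u = const3 c \<Longrightarrow> DY (subst3 f u) = const3 c * subst3 (fps_deriv f) u"
  proof (rule *[OF DY.derivation_axioms])
    show "\<exists>w i' j' l'. i' + j' + l' = Suc (i + j + l) \<and>
        (\<forall>h. coeff3 (DY h) i j l = w * coeff3 h i' j' l')" for i j l
      by (rule exI[of _ "real (Suc j)"], rule exI[of _ "i"], rule exI[of _ "Suc j"],
          rule exI[of _ "l"]) (simp add: coeff3_deriv)
  qed
  show "DZ u = const3 c \<Longrightarrow> DZ (subst3 f u) = const3 c * subst3 (fps_deriv f) u"
  proof (rule *[OF DZ.derivation_axioms])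
    show "\<exists>w i' j' l'. i' + j' + l' = Suc (i + j + l) \<and>
        (\<forall>h. coeff3 (DZ h) i j l = w * coeff3 h i' j' l')" for i j l
      by (rule exI[of _ "real (Suc l)"], rule exI[of _ "i"], rule exI[of _ "j"],
          rule exI[of _ "Suc l"]) (simp add: coeff3_deriv)
  qed
qed

lemma subst3_uminus:
  assumes "coeff3 u 0 0 0 = 0"
  shows "subst3 (- f) u = - subst3 f u"
  by (rule fps3_eqI) (simp add: coeff3_subst3[OF assms] sum_negf)

text \<open>Describes p x + q y + r z by its constant term and derivatives, which is exactly what
  the chain rule asks for.\<close>

definition linear_form :: "fps3 \<Rightarrow> real \<Rightarrow> real \<Rightarrow> real \<Rightarrow> bool" where
  "linear_form u p q r \<longleftrightarrow>
     coeff3 u 0 0 0 = 0 \<and> DX u = const3 p \<and> DY u = const3 q \<and> DZ u = const3 r"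

lemma linear_form_vars:
  "linear_form X3 1 0 0" "linear_form Y3 0 1 0" "linear_form Z3 0 0 1"
  by (auto simp: linear_form_def coeff3_vars)

lemma linear_form_add:
  assumes "linear_form u p q r" "linear_form v p' q' r'"
  shows "linear_form (u + v) (p + p') (q + q') (r + r')"
  using assms by (auto simp: linear_form_def DX.add DY.add DZ.add const3_def)

section \<open>Trigonometric identities for linear forms\<close>

lemma deriv_sin3:
  assumes "linear_form u p q r"
  shows "DX (sin3 u) = const3 p * cos3 u" "DY (sin3 u) = const3 q * cos3 u"
    "DZ (sin3 u) = const3 r * cos3 u"
  using assms deriv_subst3[of u _ "fps_sin 1"]
  by (auto simp: linear_form_def sin3_def cos3_def fps_sin_deriv)

lemma deriv_cos3:
  assumes "linear_form u p q r"
  shows "DX (cos3 u) = - (const3 p * sin3 u)" "DY (cos3 u) = - (const3 q * sin3 u)"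
    "DZ (cos3 u) = - (const3 r * sin3 u)"
proof -
  have "fps_deriv (fps_cos (1::real)) = - fps_sin 1"
    by (simp add: fps_cos_deriv fps_eq_iff)
  then show "DX (cos3 u) = - (const3 p * sin3 u)" "DY (cos3 u) = - (const3 q * sin3 u)"
    "DZ (cos3 u) = - (const3 r * sin3 u)"
    using assms deriv_subst3[of u _ "fps_cos 1"]
    by (auto simp: linear_form_def sin3_def cos3_def subst3_uminus)
qed

lemma coeff3_0_sin3: "coeff3 u 0 0 0 = 0 \<Longrightarrow> coeff3 (sin3 u) 0 0 0 = 0"
  and coeff3_0_cos3: "coeff3 u 0 0 0 = 0 \<Longrightarrow> coeff3 (cos3 u) 0 0 0 = 1"
  by (simp_all add: sin3_def cos3_def coeff3_subst3 fps_sin_def fps_cos_def)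

lemma coeff3_0_mult: "coeff3 (f * g) 0 0 0 = coeff3 f 0 0 0 * coeff3 g 0 0 0"
  by (simp add: coeff3_mult)

text \<open>All derivatives of the left side vanish and its constant term is 1.\<close>

lemma sin3_cos3_squared:
  assumes "linear_form u p q r"
  shows "sin3 u * sin3 u + cos3 u * cos3 u = 1"
proof -
  have "sin3 u * sin3 u + cos3 u * cos3 u - 1 = 0"
    by (rule fps3_deriv_zero_imp_zero, insert assms)
       (auto simp: DX.add DX.diff DX.mult DX.one DY.add DY.diff DY.mult DY.one DZ.add DZ.diff DZ.mult
         DZ.one deriv_sin3[OF assms] deriv_cos3[OF assms] coeff3_0_mult coeff3_0_sin3 coeff3_0_cos3
         linear_form_def algebra_simps)
  then show ?thesis by simp
qed

lemma const3_add: "const3 (p + q) = const3 p + const3 q"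
  by (simp add: const3_def)

text \<open>Rotating the pair of functions of u + v back by the angles v and u gives a constant.\<close>

lemma sin3_cos3_cancel:
  assumes u: "linear_form u p q r" and v: "linear_form v p' q' r'"
  shows "sin3 u = sin3 (u + v) * cos3 v - cos3 (u + v) * sin3 v"
    and "cos3 u = cos3 (u + v) * cos3 v + sin3 (u + v) * sin3 v"
proof -
  note uv = linear_form_add[OF u v]
  define f g where "f = sin3 (u + v) * cos3 v - cos3 (u + v) * sin3 v"
    and "g = cos3 (u + v) * cos3 v + sin3 (u + v) * sin3 v"
  note D = DX.add DX.diff DX.mult DX.one DY.add DY.diff DY.mult DY.one DZ.add DZ.diff DZ.mult DZ.one
  note S = deriv_sin3[OF u] deriv_cos3[OF u] deriv_sin3[OF v] deriv_cos3[OF v]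
    deriv_sin3[OF uv] deriv_cos3[OF uv]
  \<comment> \<open>\<open>f\<close> and \<open>g\<close> satisfy the differential equations and, by
    \<open>f0\<close>, the initial values of sine and cosine of \<open>u\<close>.\<close>
  have fD: "DX f = const3 p * g" "DY f = const3 q * g" "DZ f = const3 r * g"
    and gD: "DX g = - (const3 p * f)" "DY g = - (const3 q * f)" "DZ g = - (const3 r * f)"
    by (simp_all add: f_def g_def D S const3_add algebra_simps)
  have c0: "coeff3 u 0 0 0 = 0" "coeff3 v 0 0 0 = 0" "coeff3 (u + v) 0 0 0 = 0"
    using u v uv by (auto simp: linear_form_def)
  have f0: "coeff3 f 0 0 0 = 0" "coeff3 g 0 0 0 = 1"
    by (simp_all add: f_def g_def c0 coeff3_0_mult coeff3_0_sin3 coeff3_0_cos3)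
  have 1: "f * cos3 u - g * sin3 u = 0"
    by (rule fps3_deriv_zero_imp_zero)
       (simp_all add: D S fD gD f0 c0 coeff3_0_mult coeff3_0_sin3 coeff3_0_cos3 algebra_simps)
  have 2: "f * sin3 u + g * cos3 u - 1 = 0"
    by (rule fps3_deriv_zero_imp_zero)
       (simp_all add: D S fD gD f0 c0 coeff3_0_mult coeff3_0_sin3 coeff3_0_cos3 algebra_simps)
  \<comment> \<open>Solves the linear equations \<open>1\<close> and \<open>2\<close> for
    \<open>f\<close> and \<open>g\<close>; their determinant is 1.\<close>
  have "f * (sin3 u * sin3 u + cos3 u * cos3 u) =
      (f * cos3 u - g * sin3 u) * cos3 u + (f * sin3 u + g * cos3 u) * sin3 u"
    by (simp add: algebra_simps)
  moreover have "g * (sin3 u * sin3 u + cos3 u * cos3 u) =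
      (f * sin3 u + g * cos3 u) * cos3 u - (f * cos3 u - g * sin3 u) * sin3 u"
    by (simp add: algebra_simps)
  ultimately have fg: "f = sin3 u" "g = cos3 u"
    using 1 2 sin3_cos3_squared[OF u] by simp_all
  show "sin3 u = sin3 (u + v) * cos3 v - cos3 (u + v) * sin3 v"
    using fg(1)[symmetric] unfolding f_def .
  show "cos3 u = cos3 (u + v) * cos3 v + sin3 (u + v) * sin3 v"
    using fg(2)[symmetric] unfolding g_def .
qed

lemma cos3_add:
  assumes u: "linear_form u p q r" and v: "linear_form v p' q' r'"
  shows "cos3 (u + v) = cos3 u * cos3 v - sin3 u * sin3 v"
proof -
  have "cos3 u * cos3 v - sin3 u * sin3 v = cos3 (u + v) * (sin3 v * sin3 v + cos3 v * cos3 v)"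
    by (subst (1) sin3_cos3_cancel(1)[OF u v], subst (1) sin3_cos3_cancel(2)[OF u v])
       (simp add: algebra_simps)
  then show ?thesis using sin3_cos3_squared[OF v] by simp
qed

section \<open>Exchange of the variables x and z\<close>

definition swap_xz :: "fps3 \<Rightarrow> fps3" where
  "swap_xz f = Abs_fps (\<lambda>l. Abs_fps (\<lambda>j. Abs_fps (\<lambda>i. coeff3 f l j i)))"

lemma coeff3_swap_xz [simp]: "coeff3 (swap_xz f) i j l = coeff3 f l j i"
  by (simp add: swap_xz_def coeff3_def)

lemma swap_xz_simps:
  "swap_xz (f + g) = swap_xz f + swap_xz g"
  "swap_xz (f - g) = swap_xz f - swap_xz g"
  "swap_xz (- f) = - swap_xz f"
  "swap_xz 1 = 1"
  "swap_xz X3 = Z3" "swap_xz Y3 = Y3" "swap_xz Z3 = X3"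
  by (auto intro!: fps3_eqI simp: coeff3_vars)

lemma swap_xz_mult: "swap_xz (f * g) = swap_xz f * swap_xz g"
proof (rule fps3_eqI)
  fix i j l
  have "coeff3 (f * g) l j i = (\<Sum>l'=0..i. \<Sum>i'=0..l. \<Sum>j'=0..j.
      coeff3 f i' j' l' * coeff3 g (l - i') (j - j') (i - l'))"
    unfolding coeff3_mult by (intro sum.cong refl sum.swap)
  also have "\<dots> = (\<Sum>i'=0..l. \<Sum>l'=0..i. \<Sum>j'=0..j.
      coeff3 f i' j' l' * coeff3 g (l - i') (j - j') (i - l'))"
    by (rule sum.swap)
  also have "\<dots> = (\<Sum>i'=0..l. \<Sum>j'=0..j. \<Sum>l'=0..i.
      coeff3 f i' j' l' * coeff3 g (l - i') (j - j') (i - l'))"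
    by (intro sum.cong refl sum.swap)
  finally show "coeff3 (swap_xz (f * g)) i j l = coeff3 (swap_xz f * swap_xz g) i j l"
    by (simp add: coeff3_mult[of "swap_xz f"])
qed

lemma swap_xz_power: "swap_xz (f ^ n) = swap_xz f ^ n"
  by (induction n) (simp_all add: swap_xz_simps swap_xz_mult)

text \<open>The cutoff in the coefficient formula is the total degree, which the exchange preserves,
  so it suffices to exchange the powers of u.\<close>

lemma swap_xz_subst3:
  assumes "coeff3 u 0 0 0 = 0"
  shows "swap_xz (subst3 f u) = subst3 f (swap_xz u)"
proof (rule fps3_eqI)
  fix i j l
  have *: "coeff3 (swap_xz u) 0 0 0 = 0" using assms by simp
  show "coeff3 (swap_xz (subst3 f u)) i j l = coeff3 (subst3 f (swap_xz u)) i j l"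
    by (simp add: coeff3_subst3[OF assms] coeff3_subst3[OF *] swap_xz_power[symmetric] add_ac)
qed

text \<open>The series vanishing on a coordinate plane form an ideal. With the factors sin x, sin y,
  sin z this and the next two facts remove terms from the boundary conditions.\<close>

lemma coeff3_mult_x0: "(\<And>j l. coeff3 f 0 j l = 0) \<Longrightarrow> coeff3 (f * g) 0 j l = 0"
  by (simp add: coeff3_mult)

lemma coeff3_mult_y0: "(\<And>i l. coeff3 f i 0 l = 0) \<Longrightarrow> coeff3 (f * g) i 0 l = 0"
  by (simp add: coeff3_mult)

lemma coeff3_mult_z0: "(\<And>i j. coeff3 f i j 0 = 0) \<Longrightarrow> coeff3 (f * g) i j 0 = 0"
  by (simp add: coeff3_mult)

lemma coeff3_monomial:
  "coeff3 (X3 ^ p * Y3 ^ q * Z3 ^ r) i j l = (if i = p \<and> j = q \<and> l = r then 1 else 0)"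
proof -
  have "X3 ^ p * Y3 ^ q * Z3 ^ r = fps_const (fps_const (fps_X ^ p) * fps_X ^ q) * fps_X ^ r"
    by (simp add: X3_def Y3_def Z3_def fps_const_power)
  then show ?thesis
    by (auto simp: coeff3_def fps_X_power_nth)
qed

lemma coeff3_var_power:
  "coeff3 (X3 ^ n) i j l = (if i = n \<and> j = 0 \<and> l = 0 then 1 else 0)"
  "coeff3 (Y3 ^ n) i j l = (if i = 0 \<and> j = n \<and> l = 0 then 1 else 0)"
  "coeff3 (Z3 ^ n) i j l = (if i = 0 \<and> j = 0 \<and> l = n then 1 else 0)"
  using coeff3_monomial[of n 0 0 i j l] coeff3_monomial[of 0 n 0 i j l] coeff3_monomial[of 0 0 n i j l]
  by auto

lemma coeff3_trig_vars:
  "coeff3 (sin3 X3) 0 j l = 0" "coeff3 (sin3 Y3) i 0 l = 0" "coeff3 (sin3 Z3) i j 0 = 0"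
  "coeff3 (cos3 Y3) i 0 l = (if i = 0 \<and> l = 0 then 1 else 0)"
  by (auto simp: sin3_def cos3_def coeff3_subst3 coeff3_vars coeff3_var_power fps_sin_def fps_cos_def
      intro!: sum.neutral)

section \<open>The closed forms\<close>

text \<open>The exponential normalization, under which derivatives become the index shifts of the
  recursion.\<close>

definition egf_coeff :: "fps3 \<Rightarrow> nat \<Rightarrow> nat \<Rightarrow> nat \<Rightarrow> real" where
  "egf_coeff f i j l = fact i * fact j * fact l * coeff3 f i j l"

lemma egf_coeff_deriv:
  "egf_coeff (DX f) i j l = egf_coeff f (Suc i) j l"
  "egf_coeff (DY f) i j l = egf_coeff f i (Suc j) l"
  "egf_coeff (DZ f) i j l = egf_coeff f i j (Suc l)"
  by (simp_all add: egf_coeff_def coeff3_deriv algebra_simps)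

lemma egf_coeff_add: "egf_coeff (f + g) i j l = egf_coeff f i j l + egf_coeff g i j l"
  by (simp add: egf_coeff_def algebra_simps)

text \<open>Writing the closed forms with a multiplicative inverse keeps all computations inside the
  commutative ring; division returns only in the final statement.\<close>

definition sec3 :: fps3 where "sec3 = 1 / cos3 (X3 + Y3 + Z3)"

text \<open>
  Up to sign, the forms for B are found by applying \<open>\<partial>\<^sub>x - \<partial>\<^sub>y\<close>, which kills every factor except
  sin x and cos x, to the forms for A.
\<close>

definition upper_gf_a :: fps3 where
  "upper_gf_a = cos3 X3 * cos3 Z3 * sin3 (X3 + Y3 + Z3) * (sec3 * sec3)"
definition upper_gf_b :: fps3 where
  "upper_gf_b = sin3 X3 * cos3 Z3 * sin3 (X3 + Y3 + Z3) * (sec3 * sec3)"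
definition lower_gf_a :: fps3 where
  "lower_gf_a = cos3 X3 * sin3 Z3 * sec3 + sin3 X3 * cos3 (X3 + Y3) * (sec3 * sec3)"
definition lower_gf_b :: fps3 where
  "lower_gf_b = cos3 X3 * cos3 (X3 + Y3) * (sec3 * sec3) - sin3 X3 * sin3 Z3 * sec3"

lemma coeff3_0_cos3_XYZ: "coeff3 (cos3 (X3 + Y3 + Z3)) 0 0 0 = 1"
  by (rule coeff3_0_cos3) (simp add: coeff3_vars)

lemma sec3_mult_cos3: "sec3 * cos3 (X3 + Y3 + Z3) = 1"
  unfolding sec3_def by (rule divide3_mult_cancel) (simp add: coeff3_0_cos3_XYZ)

lemma divide_cos3_XYZ:
  "f / cos3 (X3 + Y3 + Z3) = f * sec3"
  "f / cos3 (X3 + Y3 + Z3) ^ 2 = f * (sec3 * sec3)"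
proof -
  let ?c = "cos3 (X3 + Y3 + Z3)"
  have *: "f / g = f * t" if "coeff3 g 0 0 0 \<noteq> 0" "t * g = 1" for g t
  proof -
    have "f * t = f / g * g * t" using divide3_mult_cancel[OF that(1)] by simp
    also have "\<dots> = f / g * (t * g)" by (simp only: mult_ac)
    finally show ?thesis using that(2) by simp
  qed
  show "f / ?c = f * sec3"
    by (rule *) (simp_all add: coeff3_0_cos3_XYZ sec3_mult_cos3)
  have "sec3 * sec3 * ?c ^ 2 = (sec3 * ?c) * (sec3 * ?c)"
    by (simp only: power2_eq_square mult_ac)
  then show "f / ?c ^ 2 = f * (sec3 * sec3)"
    by (intro *) (simp_all add: power2_eq_square coeff3_0_mult coeff3_0_cos3_XYZ sec3_mult_cos3)
qed

section \<open>Differential equations and boundary values of the closed forms\<close>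

lemma linear_form_sums:
  "linear_form (X3 + Y3) 1 1 0" "linear_form (Y3 + Z3) 0 1 1" "linear_form (X3 + Z3) 1 0 1"
  "linear_form (X3 + Y3 + Z3) 1 1 1"
  using linear_form_add[OF linear_form_vars(1,2)] linear_form_add[OF linear_form_vars(2,3)]
    linear_form_add[OF linear_form_vars(1,3)]
    linear_form_add[OF linear_form_add[OF linear_form_vars(1,2)] linear_form_vars(3)]
  by simp_all

lemma deriv_trig:
  "DX (sin3 X3) = cos3 X3" "DY (sin3 X3) = 0" "DZ (sin3 X3) = 0"
  "DX (cos3 X3) = - sin3 X3" "DY (cos3 X3) = 0" "DZ (cos3 X3) = 0"
  "DX (sin3 Z3) = 0" "DY (sin3 Z3) = 0" "DZ (sin3 Z3) = cos3 Z3"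
  "DX (cos3 Z3) = 0" "DY (cos3 Z3) = 0" "DZ (cos3 Z3) = - sin3 Z3"
  "DX (cos3 (X3 + Y3)) = - sin3 (X3 + Y3)" "DY (cos3 (X3 + Y3)) = - sin3 (X3 + Y3)"
  "DX (sin3 (X3 + Y3 + Z3)) = cos3 (X3 + Y3 + Z3)" "DY (sin3 (X3 + Y3 + Z3)) = cos3 (X3 + Y3 + Z3)"
  "DX (cos3 (X3 + Y3 + Z3)) = - sin3 (X3 + Y3 + Z3)" "DY (cos3 (X3 + Y3 + Z3)) = - sin3 (X3 + Y3 + Z3)"
  "DZ (cos3 (X3 + Y3 + Z3)) = - sin3 (X3 + Y3 + Z3)"
  using deriv_sin3[OF linear_form_vars(1)] deriv_cos3[OF linear_form_vars(1)]
    deriv_sin3[OF linear_form_vars(3)] deriv_cos3[OF linear_form_vars(3)]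
    deriv_cos3[OF linear_form_sums(1)]
    deriv_sin3[OF linear_form_sums(4)] deriv_cos3[OF linear_form_sums(4)]
  by simp_all

lemma deriv_sec3:
  "DX sec3 = sec3 * sec3 * sin3 (X3 + Y3 + Z3)"
  "DY sec3 = sec3 * sec3 * sin3 (X3 + Y3 + Z3)"
  "DZ sec3 = sec3 * sec3 * sin3 (X3 + Y3 + Z3)"
  using DX.unit_inverse[OF sec3_mult_cos3] DY.unit_inverse[OF sec3_mult_cos3]
    DZ.unit_inverse[OF sec3_mult_cos3]
  by (simp_all add: deriv_trig)

lemma gf_deriv:
  "DX upper_gf_b = DY upper_gf_b + upper_gf_a"
  "DY upper_gf_a = DX upper_gf_a + upper_gf_b"
  "DY lower_gf_b = DX lower_gf_b + lower_gf_a"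
  "DX lower_gf_a = DY lower_gf_a + lower_gf_b"
proof -
  define d where "d = (\<lambda>f. DX f - DY f)"
  interpret d: derivation d
    unfolding d_def by (rule DX.diff_derivation[OF DY.derivation_axioms])
  have [simp]: "d (sin3 X3) = cos3 X3" "d (cos3 X3) = - sin3 X3" "d (sin3 Z3) = 0" "d (cos3 Z3) = 0"
    "d (cos3 (X3 + Y3)) = 0" "d (sin3 (X3 + Y3 + Z3)) = 0" "d sec3 = 0"
    by (simp_all add: d_def deriv_trig deriv_sec3)
  have "d upper_gf_b = upper_gf_a" "d upper_gf_a = - upper_gf_b"
    "d lower_gf_b = - lower_gf_a" "d lower_gf_a = lower_gf_b"
    unfolding upper_gf_a_def upper_gf_b_def lower_gf_a_def lower_gf_b_def
    by (simp_all add: d.add d.diff d.mult)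
  then show "DX upper_gf_b = DY upper_gf_b + upper_gf_a"
    "DY upper_gf_a = DX upper_gf_a + upper_gf_b"
    "DY lower_gf_b = DX lower_gf_b + lower_gf_a"
    "DX lower_gf_a = DY lower_gf_a + lower_gf_b"
    unfolding d_def by (simp_all add: algebra_simps)
qed

text \<open>Let w = x + y + z. Since x + y = w - z, the series \<open>M\<close> is the z-derivative
  of sin z / cos w. The two forms are the rotation by x of that function and its derivative, so the
  difference of \<open>DZ lower_gf_a\<close> and \<open>lower_gf_b\<close> is a multiple of sin
  x.\<close>

lemma lower_gf_x0: "coeff3 (DZ lower_gf_a) 0 j l = coeff3 lower_gf_b 0 j l"
proof -
  let ?c = "cos3 (X3 + Y3 + Z3)" and ?s = "sin3 (X3 + Y3 + Z3)"
  define M where "M = cos3 (X3 + Y3) * (sec3 * sec3)"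
  have "cos3 (X3 + Y3) * (sec3 * sec3) = (?c * cos3 Z3 + ?s * sin3 Z3) * (sec3 * sec3)"
    using sin3_cos3_cancel(2)[OF linear_form_sums(1) linear_form_vars(3)] by simp
  also have "\<dots> = cos3 Z3 * sec3 * (sec3 * ?c) + sin3 Z3 * (sec3 * sec3 * ?s)"
    by (simp add: algebra_simps)
  finally have *: "M = cos3 Z3 * sec3 + sin3 Z3 * (sec3 * sec3 * ?s)"
    by (simp add: sec3_mult_cos3 M_def)
  have gf: "lower_gf_a = cos3 X3 * (sin3 Z3 * sec3) + sin3 X3 * M"
    "lower_gf_b = cos3 X3 * M - sin3 X3 * (sin3 Z3 * sec3)"
    by (simp_all add: lower_gf_a_def lower_gf_b_def M_def mult.assoc)
  have "DZ lower_gf_a = cos3 X3 * M + sin3 X3 * DZ M"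
    by (simp add: gf DZ.add DZ.mult deriv_trig deriv_sec3 *)
  then have "DZ lower_gf_a - lower_gf_b = sin3 X3 * (DZ M + sin3 Z3 * sec3)"
    by (simp add: gf algebra_simps)
  then have "coeff3 (DZ lower_gf_a - lower_gf_b) 0 j l = 0"
    by (simp only: coeff3_mult_x0[OF coeff3_trig_vars(1)])
  then show ?thesis by simp
qed

lemma swap_xz_trig:
  "swap_xz (sin3 X3) = sin3 Z3" "swap_xz (cos3 X3) = cos3 Z3"
  "swap_xz (sin3 Z3) = sin3 X3" "swap_xz (cos3 Z3) = cos3 X3"
  "swap_xz (cos3 (X3 + Y3)) = cos3 (Y3 + Z3)"
  "swap_xz (cos3 (X3 + Y3 + Z3)) = cos3 (X3 + Y3 + Z3)"
  by (simp_all add: sin3_def cos3_def swap_xz_subst3 coeff3_vars swap_xz_simps add_ac)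

text \<open>Inverses are unique, and cos(x + y + z) is symmetric in x and z.\<close>

lemma swap_xz_sec3: "swap_xz sec3 = sec3"
proof -
  let ?c = "cos3 (X3 + Y3 + Z3)"
  have "swap_xz sec3 * ?c = 1"
    using swap_xz_mult[of sec3 ?c] by (simp add: sec3_mult_cos3 swap_xz_trig swap_xz_simps)
  then have "sec3 = sec3 * (swap_xz sec3 * ?c)" by simp
  also have "\<dots> = swap_xz sec3 * (sec3 * ?c)" by (simp only: mult_ac)
  finally show ?thesis by (simp add: sec3_mult_cos3)
qed

text \<open>After the exchange the two forms differ by sin y / cos^2(x + y + z), found by expanding
  y = (y + z) - z and then y + z = (x + y + z) - x.\<close>

lemma gf_a_diagonal: "coeff3 upper_gf_a i 0 l = coeff3 lower_gf_a l 0 i"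
proof -
  let ?c = "cos3 (X3 + Y3 + Z3)" and ?s = "sin3 (X3 + Y3 + Z3)"
  have e: "Y3 + Z3 + X3 = X3 + Y3 + Z3" by (simp add: add_ac)
  have yz: "sin3 (Y3 + Z3) = ?s * cos3 X3 - ?c * sin3 X3"
    using sin3_cos3_cancel(1)[OF linear_form_sums(2) linear_form_vars(1)] e by simp
  have y: "sin3 Y3 = sin3 (Y3 + Z3) * cos3 Z3 - cos3 (Y3 + Z3) * sin3 Z3"
    by (rule sin3_cos3_cancel[OF linear_form_vars(2,3)])
  have "sin3 Y3 * (sec3 * sec3) =
      upper_gf_a - cos3 Z3 * sin3 X3 * sec3 * (sec3 * ?c) - sin3 Z3 * cos3 (Y3 + Z3) * (sec3 * sec3)"
    unfolding y yz upper_gf_a_def by (simp add: algebra_simps)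
  also have "\<dots> = upper_gf_a - swap_xz lower_gf_a"
    by (simp add: lower_gf_a_def swap_xz_simps swap_xz_mult swap_xz_trig swap_xz_sec3 sec3_mult_cos3)
  finally have "coeff3 (upper_gf_a - swap_xz lower_gf_a) i 0 l = 0"
    using coeff3_mult_y0[OF coeff3_trig_vars(2)] by metis
  then show ?thesis by simp
qed

text \<open>With w = x + y + z, the exchanged lower form exceeds the upper one by cos(x + z) / cos
  w. Since x + z = w - y, this equals cos y + sin y tan w, which is the constant 1 at y = 0.\<close>

lemma gf_b_diagonal:
  "coeff3 lower_gf_b l 0 i = coeff3 upper_gf_b i 0 l + (if l = 0 \<and> i = 0 then 1 else 0)"
proof -
  let ?c = "cos3 (X3 + Y3 + Z3)" and ?s = "sin3 (X3 + Y3 + Z3)"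
  have e: "Y3 + Z3 + X3 = X3 + Y3 + Z3" "X3 + Z3 + Y3 = X3 + Y3 + Z3" by (simp_all add: add_ac)
  have yz: "cos3 (Y3 + Z3) = ?c * cos3 X3 + ?s * sin3 X3"
    using sin3_cos3_cancel(2)[OF linear_form_sums(2) linear_form_vars(1)] e by simp
  have xz: "cos3 X3 * cos3 Z3 - sin3 X3 * sin3 Z3 = ?c * cos3 Y3 + ?s * sin3 Y3"
    using sin3_cos3_cancel(2)[OF linear_form_sums(3) linear_form_vars(2)]
      cos3_add[OF linear_form_vars(1,3)] e by simp
  have "swap_xz lower_gf_b =
      cos3 Z3 * cos3 (Y3 + Z3) * (sec3 * sec3) - sin3 X3 * sin3 Z3 * sec3"
    by (simp add: lower_gf_b_def swap_xz_simps swap_xz_mult swap_xz_trig swap_xz_sec3 mult_ac)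
  also have "\<dots> = (cos3 X3 * cos3 Z3) * (sec3 * (sec3 * ?c)) + upper_gf_b - sin3 X3 * sin3 Z3 * sec3"
    unfolding yz upper_gf_b_def by (simp add: algebra_simps)
  also have "\<dots> = upper_gf_b + (cos3 X3 * cos3 Z3 - sin3 X3 * sin3 Z3) * sec3"
    unfolding sec3_mult_cos3 by (simp add: algebra_simps)
  also have "\<dots> = upper_gf_b + (cos3 Y3 * (sec3 * ?c) + sin3 Y3 * (?s * sec3))"
    unfolding xz by (simp add: algebra_simps)
  finally have "swap_xz lower_gf_b = upper_gf_b + (cos3 Y3 + sin3 Y3 * (?s * sec3))"
    by (simp add: sec3_mult_cos3)
  then have "coeff3 (swap_xz lower_gf_b) i 0 l =
      coeff3 (upper_gf_b + (cos3 Y3 + sin3 Y3 * (?s * sec3))) i 0 l" by simp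
  then show ?thesis
    using coeff3_mult_y0[OF coeff3_trig_vars(2), of "?s * sec3" i l]
    by (auto simp: coeff3_trig_vars)
qed

lemma gf_system:
  "seidel_system (egf_coeff upper_gf_a) (egf_coeff upper_gf_b)
     (egf_coeff lower_gf_a) (egf_coeff lower_gf_b)"
  unfolding seidel_system_def
proof (intro conjI allI)
  fix i j l
  show "egf_coeff upper_gf_b (Suc i) j l = egf_coeff upper_gf_b i (Suc j) l + egf_coeff upper_gf_a i j l"
    "egf_coeff upper_gf_a i (Suc j) l = egf_coeff upper_gf_a (Suc i) j l + egf_coeff upper_gf_b i j l"
    "egf_coeff lower_gf_b i (Suc j) l = egf_coeff lower_gf_b (Suc i) j l + egf_coeff lower_gf_a i j l"
    "egf_coeff lower_gf_a (Suc i) j l = egf_coeff lower_gf_a i (Suc j) l + egf_coeff lower_gf_b i j l"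
    unfolding egf_coeff_deriv[symmetric] egf_coeff_add[symmetric] by (simp_all only: gf_deriv)
  show "egf_coeff upper_gf_b 0 j l = 0"
    by (simp add: egf_coeff_def upper_gf_b_def mult.assoc coeff3_mult_x0[OF coeff3_trig_vars(1)])
  \<comment> \<open>Factors are reordered so that sin z removes the first summand at z = 0 and sin x
    the second at x = 0.\<close>
  have *: "lower_gf_a = sin3 Z3 * (cos3 X3 * sec3) + sin3 X3 * (cos3 (X3 + Y3) * (sec3 * sec3))"
    by (simp add: lower_gf_a_def mult_ac)
  have "coeff3 lower_gf_a 0 j 0 = 0"
    unfolding * by (simp only: coeff3_simps coeff3_mult_x0[OF coeff3_trig_vars(1)]
        coeff3_mult_z0[OF coeff3_trig_vars(3)])
  then show "egf_coeff lower_gf_a 0 j 0 = 0"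
    by (simp add: egf_coeff_def)
  show "egf_coeff lower_gf_a 0 j (Suc l) = egf_coeff lower_gf_b 0 j l"
    unfolding egf_coeff_deriv[symmetric] by (simp add: egf_coeff_def lower_gf_x0)
  show "egf_coeff upper_gf_a i 0 l = egf_coeff lower_gf_a l 0 i"
    by (simp add: egf_coeff_def gf_a_diagonal)
  show "egf_coeff lower_gf_b l 0 i = egf_coeff upper_gf_b i 0 l + (if l = 0 \<and> i = 0 then 1 else 0)"
    by (simp add: egf_coeff_def gf_b_diagonal algebra_simps)
qed

section \<open>Reading off the coefficients of the two sums\<close>

lemma coeff3_formal_sum:
  "coeff3 (formal_sum F S) i j l = (\<Sum>s | s \<in> S \<and> coeff3 (F s) i j l \<noteq> 0. coeff3 (F s) i j l)"
  by (subst coeff3_def) (simp add: formal_sum_def)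

text \<open>The coefficient at \<open>t\<close> may itself be 0; only the other indices have to be
  excluded.\<close>

lemma coeff3_formal_sum_single:
  assumes "\<And>s. s \<in> S \<Longrightarrow> coeff3 (F s) i j l \<noteq> 0 \<Longrightarrow> s = t" and "t \<in> S"
  shows "coeff3 (formal_sum F S) i j l = coeff3 (F t) i j l"
proof -
  have "coeff3 (formal_sum F S) i j l = (\<Sum>s\<in>{t}. coeff3 (F s) i j l)"
    unfolding coeff3_formal_sum by (rule sum.mono_neutral_left) (use assms in blast)+
  then show ?thesis by simp
qed

lemma coeff3_formal_sum_zero:
  assumes "\<And>s. s \<in> S \<Longrightarrow> coeff3 (F s) i j l = 0"
  shows "coeff3 (formal_sum F S) i j l = 0"
  unfolding coeff3_formal_sum using assms by (intro sum.neutral) blast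

lemma coeff3_divpow_monomial:
  "coeff3 (of_nat c * divpow X3 p * divpow Y3 q * divpow Z3 r) i j l =
     (if i = p \<and> j = q \<and> l = r then real c / (fact i * fact j * fact l) else 0)"
proof -
  have "of_nat c = const3 (real c)"
    by (simp add: const3_def fps_of_nat)
  then have "of_nat c * divpow X3 p * divpow Y3 q * divpow Z3 r =
      const3 (real c) * (const3 (1 / fact p) * (const3 (1 / fact q) * (const3 (1 / fact r) *
        (X3 ^ p * Y3 ^ q * Z3 ^ r))))"
    by (simp add: divpow_def mult_ac)
  then show ?thesis
    by (simp add: coeff3_const_mult coeff3_monomial)
qed

theorem theorem1p3:
  fixes a b :: "nat \<Rightarrow> nat \<Rightarrow> nat \<Rightarrow> nat"
  assumes "twin_seidel a b"
  shows "formal_sum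
           (\<lambda>(n, m, k). of_nat (a (2 * n) m k) *
              divpow X3 (m - 1) * divpow Y3 (k - m - 1) * divpow Z3 (2 * n - k - 1))
           {(n, m, k). 1 \<le> n \<and> 2 \<le> m + 1 \<and> m + 1 \<le> k \<and> k \<le> 2 * n - 1}
         = cos3 X3 * cos3 Z3 * sin3 (X3 + Y3 + Z3) / cos3 (X3 + Y3 + Z3) ^ 2
         \<and>
         formal_sum
           (\<lambda>(n, m, k). of_nat (a (2 * n) m k) *
              divpow X3 (2 * n - m - 1) * divpow Y3 (m - k - 1) * divpow Z3 (k - 1))
           {(n, m, k). 1 \<le> n \<and> 2 \<le> k + 1 \<and> k + 1 \<le> m \<and> m \<le> 2 * n - 1}
         = cos3 X3 * sin3 Z3 / cos3 (X3 + Y3 + Z3)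
           + sin3 X3 * cos3 (X3 + Y3) / cos3 (X3 + Y3 + Z3) ^ 2"
    (is "formal_sum ?F ?S = _ \<and> formal_sum ?G ?R = _")
proof -
  \<comment> \<open>By uniqueness the entries are the normalized coefficients of the closed forms;
    it remains to locate the entries in the two sums.\<close>
  note eq = seidel_system_unique[OF twin_seidel_system[OF assms] gf_system]
  have "coeff3 (formal_sum ?F ?S) i j l = upper_entries True a i j l / (fact i * fact j * fact l)"
    for i j l
  proof (cases "odd (i + j + l)")
    case True
    \<comment> \<open>Solves i = m - 1, j = k - m - 1, l = 2 n - k - 1; halving is exact because i +
      j + l is odd.\<close>
    define t where "t = ((i + j + l + 3) div 2, i + 1, i + j + 2)"
    have n: "2 * ((i + j + l + 3) div 2) = i + j + l + 3" using True by simp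
    have "coeff3 (formal_sum ?F ?S) i j l = coeff3 (?F t) i j l"
    proof (rule coeff3_formal_sum_single)
      show "s = t" if "s \<in> ?S" "coeff3 (?F s) i j l \<noteq> 0" for s
        using that by (auto simp: coeff3_divpow_monomial t_def split: if_splits)
      show "t \<in> ?S" using n by (auto simp: t_def)
    qed
    then show ?thesis
      using True n by (simp add: t_def coeff3_divpow_monomial upper_entries_def)
  next
    case False
    have "coeff3 (formal_sum ?F ?S) i j l = 0"
    proof (rule coeff3_formal_sum_zero)
      fix s assume s: "s \<in> ?S"
      obtain n m k where nmk: "s = (n, m, k)" by (cases s)
      \<comment> \<open>The exponents of every summand add up to the odd number 2 n - 3.\<close>
      have "\<not> (i = m - 1 \<and> j = k - m - 1 \<and> l = 2 * n - k - 1)"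
      proof
        assume "i = m - 1 \<and> j = k - m - 1 \<and> l = 2 * n - k - 1"
        then have "i + j + l + 3 = 2 * n" using s unfolding nmk by auto
        then show False using False by presburger
      qed
      then show "coeff3 (?F s) i j l = 0"
        unfolding nmk by (auto simp: coeff3_divpow_monomial)
    qed
    then show ?thesis using False by (simp add: upper_entries_def)
  qed
  then have "formal_sum ?F ?S = upper_gf_a"
    by (intro fps3_eqI) (simp add: eq egf_coeff_def)
  moreover have "coeff3 (formal_sum ?G ?R) i j l = lower_entries True a i j l / (fact i * fact j * fact l)"
    for i j l
  proof (cases "odd (i + j + l)")
    case True
    \<comment> \<open>Solves i = 2 n - m - 1, j = m - k - 1, l = k - 1.\<close>
    define t where "t = ((i + j + l + 3) div 2, j + l + 2, l + 1)"
    have n: "2 * ((i + j + l + 3) div 2) = i + j + l + 3" using True by simp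
    have "coeff3 (formal_sum ?G ?R) i j l = coeff3 (?G t) i j l"
    proof (rule coeff3_formal_sum_single)
      show "s = t" if "s \<in> ?R" "coeff3 (?G s) i j l \<noteq> 0" for s
        using that by (auto simp: coeff3_divpow_monomial t_def split: if_splits)
      show "t \<in> ?R" using n by (auto simp: t_def)
    qed
    then show ?thesis
      using True n by (simp add: t_def coeff3_divpow_monomial lower_entries_def)
  next
    case False
    have "coeff3 (formal_sum ?G ?R) i j l = 0"
    proof (rule coeff3_formal_sum_zero)
      fix s assume s: "s \<in> ?R"
      obtain n m k where nmk: "s = (n, m, k)" by (cases s)
      have "\<not> (i = 2 * n - m - 1 \<and> j = m - k - 1 \<and> l = k - 1)"
      proof
        assume "i = 2 * n - m - 1 \<and> j = m - k - 1 \<and> l = k - 1"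
        then have "i + j + l + 3 = 2 * n" using s unfolding nmk by auto
        then show False using False by presburger
      qed
      then show "coeff3 (?G s) i j l = 0"
        unfolding nmk by (auto simp: coeff3_divpow_monomial)
    qed
    then show ?thesis using False by (simp add: lower_entries_def)
  qed
  then have "formal_sum ?G ?R = lower_gf_a"
    by (intro fps3_eqI) (simp add: eq egf_coeff_def)
  ultimately show ?thesis
    by (simp add: divide_cos3_XYZ upper_gf_a_def lower_gf_a_def)
qed

end
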